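(* Let $G = G[K_1,K_2]$ be a co-chain graph, i.e. a finite simple graph whose vertex set is partitioned into two cliques $K_1$ and $K_2$ such that, on each side, the neighborhoods of the vertices in the other side are linearly ordered by inclusion. If $|K_1|$ and $|K_2|$ are both even, then $\tau(G) \leq 2\,\nu(G)$.
   Context: All graphs are finite and simple. A triangle hitting of a graph $G$ is a set of edges of $G$ whose removal results in a triangle-free graph; $\tau(G)$ denotes the minimum cardinality of a triangle hitting of $G$. A triangle packing of $G$ is a set of pairwise edge-disjoint triangles of $G$; $\nu(G)$ denotes the maximum cardinality of a triangle packing of $G$. For a vertex $v$, $N(v)$ denotes the set of neighbors of $v$. A co-bipartite graph is a graph whose complement is bipartite, i.e. there is a partition $\{K_1,K_2\}$ of $V(G)$ such that the induced subgraphs $G[K_1]$ and $G[K_2]$ are complete; such a graph together with this partition is written $G[K_1,K_2]$. A co-chain graph $G[K_1,K_2]$ is a co-bipartite graph with such a partition in which the vertices of $K_1$ can be named $c_1,\ldots,c_{|K_1|}$ and the vertices of $K_2$ can be named $d_1,\ldots,d_{|K_2|}$ so that $N(c_{i+1})\cap K_2 \subseteq N(c_i)\cap K_2$ for $i=1,\ldots,|K_1|-1$ and $N(d_i)\cap K_1 \subseteq N(d_{i+1})\cap K_1$ for $i=1,\ldots,|K_2|-1$. *)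

theory Defs
  imports "HOL-Library.Ramsey"
begin

text \<open>
  A graph is given by its vertex set \<open>V\<close> and its set \<open>E\<close> of two-element edges; \<open>[A]\<^bsup>n\<^esup>\<close> is the set
  of \<open>n\<close>-element subsets of \<open>A\<close>, and \<open>clique\<close> is taken from the Ramsey theory.
\<close>

definition fin_simple_graph :: "'a set \<Rightarrow> 'a set set \<Rightarrow> bool" where
  "fin_simple_graph V E \<longleftrightarrow> finite V \<and> E \<subseteq> [V]\<^bsup>2\<^esup>"

definition nbhd :: "'a set set \<Rightarrow> 'a \<Rightarrow> 'a set" where
  "nbhd E v = {u. {v, u} \<in> E}"

text \<open>
  A triangle is identified with its vertex set; its edges are \<open>[T]\<^bsup>2\<^esup>\<close>. No reference to \<open>V\<close> is needed,
  as each vertex of a triangle is an endpoint of an edge.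
\<close>

definition triangles :: "'a set set \<Rightarrow> 'a set set" where
  "triangles E = {T. card T = 3 \<and> clique T E}"

definition triangle_hitting :: "'a set set \<Rightarrow> 'a set set \<Rightarrow> bool" where
  "triangle_hitting E F \<longleftrightarrow> F \<subseteq> E \<and> triangles (E - F) = {}"

definition triangle_packing :: "'a set set \<Rightarrow> 'a set set \<Rightarrow> bool" where
  "triangle_packing E P \<longleftrightarrow>
     P \<subseteq> triangles E \<and> pairwise (\<lambda>S T. [S]\<^bsup>2\<^esup> \<inter> [T]\<^bsup>2\<^esup> = {}) P"

definition tau :: "'a set set \<Rightarrow> nat" where
  "tau E = Min (card ` {F. triangle_hitting E F})"

definition nu :: "'a set set \<Rightarrow> nat" where
  "nu E = Max (card ` {P. triangle_packing E P})"

text \<open>In a finite simple graph the minimum and the maximum range over finite nonempty sets.\<close>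

lemma triangle_hittings_finite_nonempty:
  assumes "fin_simple_graph V E"
  shows "finite {F. triangle_hitting E F}" and "{F. triangle_hitting E F} \<noteq> {}"
proof -
  have fin: "finite E"
    using assms finite_subset finite_imp_finite_nsets unfolding fin_simple_graph_def by blast
  have "{F. triangle_hitting E F} \<subseteq> Pow E"
    by (auto simp: triangle_hitting_def)
  then show "finite {F. triangle_hitting E F}"
    using fin by (simp add: finite_subset)
  have "triangle_hitting E E"
    by (auto simp: triangle_hitting_def triangles_def clique_def card_3_iff)
  then show "{F. triangle_hitting E F} \<noteq> {}" by blast
qed

lemma triangle_packings_finite_nonempty:
  assumes "fin_simple_graph V E"
  shows "finite {P. triangle_packing E P}" and "{P. triangle_packing E P} \<noteq> {}"
proof -
  have "triangles E \<subseteq> Pow V"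
  proof (clarsimp simp: triangles_def card_3_iff clique_def)
    fix w x y z
    assume "{x, y} \<in> E" "{x, z} \<in> E" "w = x \<or> w = y \<or> w = z"
    then show "w \<in> V" using assms by (auto simp: fin_simple_graph_def nsets_def)
  qed
  moreover have "finite V" using assms by (simp add: fin_simple_graph_def)
  ultimately have fin: "finite (triangles E)" using finite_subset by blast
  have "{P. triangle_packing E P} \<subseteq> Pow (triangles E)"
    by (auto simp: triangle_packing_def)
  then show "finite {P. triangle_packing E P}"
    using fin by (simp add: finite_subset)
  have "triangle_packing E {}" by (simp add: triangle_packing_def)
  then show "{P. triangle_packing E P} \<noteq> {}" by blast
qed

text \<open>One of the two parts may be empty.\<close>

definition co_bipartite :: "'a set \<Rightarrow> 'a set set \<Rightarrow> 'a set \<Rightarrow> 'a set \<Rightarrow> bool" where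
  "co_bipartite V E K1 K2 \<longleftrightarrow>
     fin_simple_graph V E \<and> K1 \<union> K2 = V \<and> K1 \<inter> K2 = {} \<and> clique K1 E \<and> clique K2 E"

definition co_chain :: "'a set \<Rightarrow> 'a set set \<Rightarrow> 'a set \<Rightarrow> 'a set \<Rightarrow> bool" where
  "co_chain V E K1 K2 \<longleftrightarrow>
     co_bipartite V E K1 K2 \<and>
     (\<exists>c d. bij_betw c {1..card K1} K1 \<and> bij_betw d {1..card K2} K2 \<and>
        (\<forall>i::nat\<in>{1..<card K1}. nbhd E (c (i + 1)) \<inter> K2 \<subseteq> nbhd E (c i) \<inter> K2) \<and>
        (\<forall>i::nat\<in>{1..<card K2}. nbhd E (d i) \<inter> K1 \<subseteq> nbhd E (d (i + 1)) \<inter> K1))"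

end

theory Submission
  imports Defs Complex_Main
begin

text \<open>
Let \<open>2 p\<close> and \<open>2 q\<close> be the sizes of the two cliques, with vertices \<open>c 0, c 1, \<dots>\<close> and \<open>d 0, d 1, \<dots>\<close>
ordered by decreasing neighbourhoods. The edges between the cliques then form a staircase in a
\<open>2 p \<times> 2 q\<close> box: \<open>c i\<close> is adjacent to \<open>d j\<close> iff \<open>j < r i\<close>. Cells of the box are edges between the cliques;
rows are vertices \<open>c i\<close>, columns are vertices \<open>d j\<close>.

\<^emph>\<open>Hitting.\<close> Cutting the vertex set into two parts and deleting the edges inside the parts leaves a
bipartite graph (\<open>tau_le_cut\<close>). If each clique is cut in half this costs \<open>p (p - 1) + q (q - 1)\<close> edges
inside the cliques, plus the cells of two opposite quadrants of the box; which pair of quadrants is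
lost can be chosen. Moving \<open>e\<close> vertices of one clique across the cut costs only \<open>e\<^sup>2\<close> more inside it.

\<^emph>\<open>Packing.\<close> Split one clique into halves \<open>x\<close> and \<open>z\<close> of size \<open>q\<close>. A symmetric Latin square properly
colours the edges inside \<open>x\<close> by vertices of \<open>z\<close>, which gives \<open>q (q - 1) / 2\<close> triangles that use no edge
inside \<open>z\<close>. The same square colours the edges inside \<open>z\<close>, and each of its colour classes can be
given to one outside vertex that is adjacent to all of \<open>z\<close> (\<open>clique_gadget\<close>). Doing this in both
cliques, the packing has half as many triangles as the halving cut loses edges inside the cliques, and
one further triangle for roughly every two cells of two disjoint full rectangles, a set of rows
times a window of \<open>q\<close> columns and a window of \<open>p\<close> rows times a set of columns (\<open>two_nu_ge\<close>). So it
remains to cover by such rectangles as many cells as a suitable cut loses.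

\<^emph>\<open>Sparse case\<close>: the cell \<open>(p, q)\<close> is absent, so the quadrant of large indices is empty. Put the two
neighbouring quadrants as staircases into one \<open>p \<times> q\<close> grid. A corner \<open>(s, t)\<close> of either
staircase yields a pair of rectangles with \<open>s q + t p\<close> cells. If \<open>M\<close> is the best of these
values, both staircases lie essentially below the line \<open>s q + t p = M\<close>, and then their total area is
at most \<open>M\<close> (\<open>two_staircases_le\<close>) unless \<open>M\<close> exceeds the area of the whole grid. In the first case the cut
that loses the two staircases is cheap enough, in the second the cut that loses the quadrant of
small indices.

\<^emph>\<open>Dense case\<close>: the cell \<open>(p, q)\<close> is present. Here the cut that loses the quadrants of small and of large
indices is matched by the first columns together with as many rows as possible.

\<^emph>\<open>Choice of the partition.\<close> A vertex adjacent to all others can be counted in either clique, so pairs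
of such vertices can be moved across (\<open>shift\<close>). The sparse argument is applied to the most balanced
sparse partition; if no partition is sparse, the dense argument is applied to the most unbalanced
one. Both choices exclude the configurations with too many universal vertices on the wrong side.
\<close>

section \<open>Edge-disjoint families of triangles\<close>

definition edge_disjoint :: "'a set set \<Rightarrow> bool" where
  "edge_disjoint P \<longleftrightarrow>
     (\<forall>S\<in>P. \<forall>T\<in>P. \<forall>a b. a \<noteq> b \<and> a \<in> S \<and> b \<in> S \<and> a \<in> T \<and> b \<in> T \<longrightarrow> S = T)"

lemma triangle_packingI:
  assumes "P \<subseteq> triangles E" and "edge_disjoint P"
  shows "triangle_packing E P"
proof -
  have "[S]\<^bsup>2\<^esup> \<inter> [T]\<^bsup>2\<^esup> = {}" if "S \<in> P" "T \<in> P" "S \<noteq> T" for S T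
  proof (rule ccontr)
    assume "[S]\<^bsup>2\<^esup> \<inter> [T]\<^bsup>2\<^esup> \<noteq> {}"
    then obtain e where "e \<in> [S]\<^bsup>2\<^esup>" "e \<in> [T]\<^bsup>2\<^esup>" by blast
    then obtain a b where "a \<noteq> b" "a \<in> S" "b \<in> S" "a \<in> T" "b \<in> T"
      by (auto simp: nsets_def card_2_iff)
    then show False using assms(2) that unfolding edge_disjoint_def by blast
  qed
  then show ?thesis
    using assms(1) by (auto simp: triangle_packing_def pairwise_def)
qed

lemma edge_disjoint_image:
  assumes "edge_disjoint P" and "inj_on f D" and "\<Union>P \<subseteq> D"
  shows "edge_disjoint ((`) f ` P)"
  unfolding edge_disjoint_def
proof (intro ballI allI impI, elim conjE)
  fix S' T' a' b'
  assume "S' \<in> (`) f ` P" "T' \<in> (`) f ` P"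
  then obtain S T where ST: "S \<in> P" "T \<in> P" "S' = f ` S" "T' = f ` T" by blast
  assume "a' \<noteq> b'" "a' \<in> S'" "b' \<in> S'" "a' \<in> T'" "b' \<in> T'"
  then obtain a b a2 b2 where ab: "a \<in> S" "b \<in> S" "a2 \<in> T" "b2 \<in> T"
    "a' = f a" "b' = f b" "f a2 = f a" "f b2 = f b" "a \<noteq> b"
    unfolding ST by (smt (verit) imageE)
  have "S \<subseteq> D" "T \<subseteq> D" using ST assms(3) by auto
  then have "a2 = a" "b2 = b" using ab assms(2) by (auto dest: inj_onD)
  then have "S = T" using assms(1) ST ab unfolding edge_disjoint_def by blast
  then show "S' = T'" using ST by simp
qed

section \<open>Symmetric Latin squares\<close>

definition sym_latin :: "nat \<Rightarrow> (nat \<Rightarrow> nat \<Rightarrow> nat) \<Rightarrow> bool" where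
  "sym_latin q \<kappa> \<longleftrightarrow>
     (\<forall>i<q. \<forall>j<q. \<kappa> i j < q \<and> \<kappa> i j = \<kappa> j i) \<and> (\<forall>i<q. inj_on (\<kappa> i) {..<q})"

lemma sym_latinD:
  assumes "sym_latin q \<kappa>" "i < q" "j < q"
  shows "\<kappa> i j < q" "\<kappa> i j = \<kappa> j i" "j' < q \<Longrightarrow> \<kappa> i j = \<kappa> i j' \<longleftrightarrow> j = j'"
proof -
  show "\<kappa> i j < q" "\<kappa> i j = \<kappa> j i" using assms unfolding sym_latin_def by blast+
  show "j' < q \<Longrightarrow> \<kappa> i j = \<kappa> i j' \<longleftrightarrow> j = j'"
    using assms unfolding sym_latin_def inj_on_def by blast
qed

text \<open>
The entry of \<open>i\<close> and \<open>j\<close> is half of \<open>i + j\<close> modulo \<open>q\<close>; \<open>h\<close> is the inverse of \<open>2\<close>.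
\<close>

lemma sym_latin_idempotent_exists:
  assumes "odd q"
  obtains \<kappa> where "sym_latin q \<kappa>" "\<And>i. i < q \<Longrightarrow> \<kappa> i i = i"
proof
  define h where "h = (q + 1) div 2"
  have h: "h * 2 = q + 1" unfolding h_def using assms by simp presburger
  have half: "((n * h) mod q * 2) mod q = n mod q" for n
  proof -
    have "((n * h) mod q * 2) mod q = (n * (h * 2)) mod q"
      by (simp only: mod_mult_left_eq mult.assoc)
    also have "\<dots> = (n + q * n) mod q" unfolding h by (simp add: algebra_simps)
    finally show ?thesis by simp
  qed
  let ?k = "\<lambda>i j. ((i + j) * h) mod q"
  have q: "q > 0" using assms by (cases q) auto
  have le: "j \<le> j'" if "j < q" "j' < q" "?k i j = ?k i j'" for i j j'
  proof (rule ccontr)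
    assume "\<not> j \<le> j'"
    have "(i + j) mod q = (i + j') mod q" using that(3) by (metis half)
    then have "q dvd (i + j) - (i + j')" using \<open>\<not> j \<le> j'\<close> by (subst mod_eq_dvd_iff_nat[symmetric]) auto
    then show False using that \<open>\<not> j \<le> j'\<close> by (auto dest: dvd_imp_le)
  qed
  have "inj_on (?k i) {..<q}" for i
    by (intro inj_onI antisym) (rule le[where i = i]; simp)+
  then show "sym_latin q ?k" using q by (auto simp: sym_latin_def add.commute)
  show "?k i i = i" if "i < q" for i
  proof -
    have "(i + i) * h = i + q * i" 
    proof -
      have "(i + i) * h = i * (h * 2)" by (simp add: algebra_simps)
      then show ?thesis unfolding h by simp
    qed
    then show ?thesis using that by simp
  qed
qed

text \<open>
The usual step from near-perfect to perfect matchings: in an idempotent square of order \<open>q - 1\<close> the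
symbol \<open>i\<close> moves from the diagonal place \<open>i\<close> to the places shared with a new index \<open>n\<close>, and a new
symbol \<open>0\<close> fills the diagonal.
\<close>

lemma sym_latin_unipotent_exists:
  assumes "even q" "q > 0"
  obtains \<kappa> where "sym_latin q \<kappa>" "\<And>i. i < q \<Longrightarrow> \<kappa> i i = 0"
proof -
  define n where "n = q - 1"
  have q: "q = Suc n" and "odd n" using assms by (auto simp: n_def)
  obtain l where l: "sym_latin n l" "\<And>i. i < n \<Longrightarrow> l i i = i"
    using sym_latin_idempotent_exists[OF \<open>odd n\<close>] by blast
  define \<kappa> where "\<kappa> i j = (if i = j then 0 else if j = n then i + 1
      else if i = n then j + 1 else l i j + 1)" for i j
  have "inj_on (\<kappa> i) {..<q}" if "i < q" for i
  proof (rule inj_onI)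
    fix j j' assume "j \<in> {..<q}" "j' \<in> {..<q}" and eq: "\<kappa> i j = \<kappa> i j'"
    then have lt: "j < q" "j' < q" by auto
    have lij: "l i a = l i b \<longleftrightarrow> a = b" if "i < n" "a < n" "b < n" for a b
      using sym_latinD(3)[OF l(1)] that by blast
    show "j = j'"
      using lt that eq lij[of j j'] lij[of i j] lij[of j i] lij[of i j'] lij[of j' i] l(2)[of i] unfolding \<kappa>_def q
      by (auto split: if_splits simp: less_Suc_eq)
  qed
  moreover have "\<kappa> i j < q \<and> \<kappa> i j = \<kappa> j i" if "i < q" "j < q" for i j
    using that sym_latinD(1,2)[OF l(1), of i j] unfolding \<kappa>_def q
    by (auto simp: less_Suc_eq)
  ultimately have "sym_latin q \<kappa>" by (auto simp: sym_latin_def)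
  moreover have "\<kappa> i i = 0" for i by (simp add: \<kappa>_def)
  ultimately show ?thesis using that by blast
qed

lemma card_ordered_pairs_of_symbol:
  assumes "sym_latin q \<kappa>" "t < q"
  shows "card {(i, j). i < q \<and> j < q \<and> \<kappa> i j = t} = q"
proof -
  have ex: "\<exists>!j. j < q \<and> \<kappa> i j = t" if "i < q" for i
  proof -
    have "inj_on (\<kappa> i) {..<q}" "\<kappa> i ` {..<q} \<subseteq> {..<q}"
      using assms(1) that by (auto simp: sym_latin_def)
    then have "\<kappa> i ` {..<q} = {..<q}" by (simp add: endo_inj_surj)
    then obtain j where "j < q" "\<kappa> i j = t" using assms(2) by (metis imageE lessThan_iff)
    then show ?thesis using sym_latinD(3)[OF assms(1) that] by (metis)
  qed
  define g where "g i = (THE j. j < q \<and> \<kappa> i j = t)" for i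
  have g: "g i < q" "\<kappa> i (g i) = t" "j < q \<Longrightarrow> \<kappa> i j = t \<Longrightarrow> j = g i" if "i < q" for i j
    using theI'[OF ex[OF that]] ex[OF that] unfolding g_def by blast+
  have "{(i, j). i < q \<and> j < q \<and> \<kappa> i j = t} = (\<lambda>i. (i, g i)) ` {..<q}"
    using g by auto
  then show ?thesis by (simp add: card_image inj_on_def)
qed

text \<open>
A symbol is a colour class of edges \<open>{i, j}\<close>; it misses exactly the indices that carry it on the
diagonal.
\<close>

lemma card_pairs_of_symbol:
  assumes "sym_latin q \<kappa>" "t < q"
  shows "2 * card {(i, j). i < j \<and> j < q \<and> \<kappa> i j = t} + card {i. i < q \<and> \<kappa> i i = t} = q"
proof -
  let ?A = "{(i, j). i < j \<and> j < q \<and> \<kappa> i j = t}"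
  let ?D = "{i. i < q \<and> \<kappa> i i = t}"
  have fin: "finite ?A"
    by (rule finite_subset[of _ "{..<q} \<times> {..<q}"]) auto
  have "{(i, j). i < q \<and> j < q \<and> \<kappa> i j = t} = ?A \<union> prod.swap ` ?A \<union> (\<lambda>i. (i, i)) ` ?D"
  proof (intro set_eqI iffI)
    fix w assume "w \<in> {(i, j). i < q \<and> j < q \<and> \<kappa> i j = t}"
    then obtain i j where w: "w = (i, j)" "i < q" "j < q" "\<kappa> i j = t" by blast
    then have "\<kappa> j i = t" using sym_latinD(2)[OF assms(1)] by metis
    then show "w \<in> ?A \<union> prod.swap ` ?A \<union> (\<lambda>i. (i, i)) ` ?D"
      using w by (cases i j rule: linorder_cases) (auto simp: image_iff)
  next
    fix w assume "w \<in> ?A \<union> prod.swap ` ?A \<union> (\<lambda>i. (i, i)) ` ?D"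
    then show "w \<in> {(i, j). i < q \<and> j < q \<and> \<kappa> i j = t}"
      using sym_latinD(2)[OF assms(1)] by auto
  qed
  then have "q = card (?A \<union> prod.swap ` ?A \<union> (\<lambda>i. (i, i)) ` ?D)"
    using card_ordered_pairs_of_symbol[OF assms] by simp
  also have "\<dots> = card (?A \<union> prod.swap ` ?A) + card ((\<lambda>i. (i, i)) ` ?D)"
    using fin by (intro card_Un_disjoint) auto
  also have "card (?A \<union> prod.swap ` ?A) = card ?A + card (prod.swap ` ?A)"
    using fin by (intro card_Un_disjoint) auto
  also have "card (prod.swap ` ?A) = card ?A" by (simp add: card_image)
  also have "card ((\<lambda>i. (i, i)) ` ?D) = card ?D" by (simp add: card_image inj_on_def)
  finally show ?thesis by simp
qed

section \<open>Packing an even clique together with outside apexes\<close>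

text \<open>
Twice the number of triangles that \<open>m\<close> outside apexes add, when \<open>s\<close> of them have a neighbour of their own
in the half not used for them. For odd \<open>q\<close> a colour class misses one vertex of the half, and such an
apex gets a further triangle through the missed vertex. For even \<open>q\<close> the classes are perfect but
there are only \<open>q - 1\<close> of them, so that the last of \<open>q\<close> apexes can get nothing except one triangle of the
latter kind.
\<close>

definition gain :: "nat \<Rightarrow> nat \<Rightarrow> nat \<Rightarrow> nat" where
  "gain q m s = (if odd q then m * (q - 1) + 2 * s
     else if m < q then m * q else m * (q - 1) + 2 * min 1 s)"

text \<open>
Model vertices are pairs of a role and an index, so that all incidences below are decided by the
simplifier: the outer half is the one whose edges are coloured by the inner half, and
the edges of the inner half are the ones given to the apexes.
\<close>

datatype role = Outer | Inner | Apex

text \<open>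
Edge-disjointness is the Latin property, since any two of the three entries row, column, symbol determine
the third. The triangles of \<open>Sp\<close> use precisely the edges forgotten by the square: with \<open>\<kappa> k k = k\<close>, the outer
vertex \<open>k\<close> never meets the inner vertex \<open>k\<close>, and the apex of colour \<open>k\<close> never meets it either.
\<close>

lemma latin_packing:
  fixes \<kappa> :: "nat \<Rightarrow> nat \<Rightarrow> nat" and \<phi> :: "nat \<Rightarrow> nat"
  assumes \<kappa>: "sym_latin q \<kappa>"
    and \<phi>: "inj_on \<phi> {..<m}" "\<phi> ` {..<m} \<subseteq> {..<q}"
    and sp: "Sp \<subseteq> {..<m}" "\<And>k. k \<in> Sp \<Longrightarrow> k < q \<and> \<phi> k = k \<and> \<kappa> k k = k"
  defines "P \<equiv> (\<lambda>(i, j). {(Outer, i), (Outer, j), (Inner, \<kappa> i j)}) ` {(i, j). i < j \<and> j < q}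
      \<union> (\<lambda>(k, i, j). {(Apex, k), (Inner, i), (Inner, j)}) ` {(k, i, j). k < m \<and> i < j \<and> j < q \<and> \<kappa> i j = \<phi> k}
      \<union> (\<lambda>k. {(Apex, k), (Inner, k), (Outer, k)}) ` Sp"
  shows "edge_disjoint P"
    and "2 * card P + (\<Sum>k<m. card {i. i < q \<and> \<kappa> i i = \<phi> k}) = q * (q - 1) + m * q + 2 * card Sp"
proof -
  let ?A = "{(i, j). i < j \<and> j < q}"
  let ?B = "{(k, i, j). k < m \<and> i < j \<and> j < q \<and> \<kappa> i j = \<phi> k}"
  let ?f = "\<lambda>(i, j). {(Outer, i), (Outer, j), (Inner, \<kappa> i j)}"
  let ?g = "\<lambda>(k, i, j). {(Apex, k), (Inner, i), (Inner, j)}"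
  let ?h = "\<lambda>k. {(Apex, k), (Inner, k), (Outer, k)}"
  have canc: "\<kappa> i j = \<kappa> i j' \<longleftrightarrow> j = j'" "\<kappa> j i = \<kappa> j' i \<longleftrightarrow> j = j'"
     "\<kappa> i j = \<kappa> j' i \<longleftrightarrow> j = j'" "\<kappa> j i = \<kappa> i j' \<longleftrightarrow> j = j'" if "i < q" "j < q" "j' < q" for i j j'
    using sym_latinD[OF \<kappa>] that by metis+
  have \<phi>i: "\<phi> k = \<phi> k' \<longleftrightarrow> k = k'" if "k < m" "k' < m" for k k'
    using \<phi>(1) that by (auto dest: inj_onD)
  have sp': "\<kappa> k i = k \<longleftrightarrow> i = k" "\<kappa> i k = k \<longleftrightarrow> i = k" if "k \<in> Sp" "i < q" for k i
    using canc(1)[of k i k] canc(2)[of k i k] sp(2)[of k] that by auto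
  have mem: "(\<exists>i j. W = ?f (i, j) \<and> i < j \<and> j < q)
      \<or> (\<exists>k i j. W = ?g (k, i, j) \<and> k < m \<and> i < j \<and> j < q \<and> \<kappa> i j = \<phi> k)
      \<or> (\<exists>k. W = ?h k \<and> k \<in> Sp)" if "W \<in> P" for W
    using that unfolding P_def by auto
  have fg: False if "a \<noteq> b" "a \<in> ?f (i, j)" "b \<in> ?f (i, j)" "a \<in> ?g (k', i', j')" "b \<in> ?g (k', i', j')"
    for a b i j k' i' j' using that by auto
  have fh: False if "a \<noteq> b" "a \<in> ?f (i, j)" "b \<in> ?f (i, j)" "a \<in> ?h k" "b \<in> ?h k"
    "i < j" "j < q" "k \<in> Sp" for a b i j k
  proof -
    have "\<kappa> k j \<noteq> k" if "k = i" using that \<open>k \<in> Sp\<close> \<open>i < j\<close> \<open>j < q\<close> sp'(1)[of k j] by blast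
    moreover have "\<kappa> i k \<noteq> k" if "k = j" using that \<open>k \<in> Sp\<close> \<open>i < j\<close> \<open>j < q\<close> sp'(2)[of k i] by force
    ultimately show False using that(1-5) by auto
  qed
  have gh: False if "a \<noteq> b" "a \<in> ?g (k, i, j)" "b \<in> ?g (k, i, j)" "a \<in> ?h k'" "b \<in> ?h k'"
    "i < j" "j < q" "\<kappa> i j = \<phi> k" "k' \<in> Sp" for a b i j k k'
  proof -
    have "\<kappa> k' j \<noteq> k'" if "k' = i" using that \<open>k' \<in> Sp\<close> \<open>i < j\<close> \<open>j < q\<close> sp'(1)[of k' j] by blast
    moreover have "\<kappa> i k' \<noteq> k'" if "k' = j" using that \<open>k' \<in> Sp\<close> \<open>i < j\<close> \<open>j < q\<close> sp'(2)[of k' i] by force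
    moreover have "\<kappa> i j = k'" if "k = k'" using that \<open>\<kappa> i j = \<phi> k\<close> \<open>k' \<in> Sp\<close> sp(2)[of k'] by simp
    ultimately show False using that(1-5) by auto
  qed
  have ff: "?f (i, j) = ?f (i', j')" if "a \<noteq> b" "a \<in> ?f (i, j)" "b \<in> ?f (i, j)" "a \<in> ?f (i', j')" "b \<in> ?f (i', j')"
    "i < j" "j < q" "i' < j'" "j' < q" for a b i j i' j'
  proof -
    have "i < q" "i' < q" using that by auto
    then show ?thesis
      using that canc[of i j j'] canc[of i j i'] canc[of j i i'] canc[of j i j'] by auto
  qed
  have gg: "?g (k, i, j) = ?g (k', i', j')"
    if "a \<noteq> b" "a \<in> ?g (k, i, j)" "b \<in> ?g (k, i, j)" "a \<in> ?g (k', i', j')" "b \<in> ?g (k', i', j')"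
    "i < j" "j < q" "i' < j'" "j' < q" "\<kappa> i j = \<phi> k" "\<kappa> i' j' = \<phi> k'" "k < m" "k' < m" for a b k i j k' i' j'
  proof -
    have lt: "i < q" "i' < q" using that by auto
    have "i = i' \<and> j = j' \<or> k = k' \<and> (i = i' \<or> j = j' \<or> i = j' \<or> j = i')"
      using that(1-5) \<open>i < j\<close> \<open>i' < j'\<close> by auto
    then have "k = k' \<and> i = i' \<and> j = j'"
    proof
      assume "i = i' \<and> j = j'"
      then show ?thesis using \<phi>i[OF \<open>k < m\<close> \<open>k' < m\<close>] that(10,11) by metis
    next
      assume *: "k = k' \<and> (i = i' \<or> j = j' \<or> i = j' \<or> j = i')"
      then have eq: "\<kappa> i j = \<kappa> i' j'" using that(10,11) by metis
      from * consider "i = i'" | "j = j'" | "i = j'" | "j = i'" by blast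
      then show ?thesis
      proof cases
        case 1
        then show ?thesis using * eq canc(1)[of i j j'] lt that(7,9) by metis
      next
        case 2
        then show ?thesis using * eq canc(2)[of j i i'] lt that(7,9) by metis
      next
        case 3
        then have "j = i'" using eq canc(3)[of i j i'] lt that(7) by metis
        then show ?thesis using 3 that(6,8) by simp
      next
        case 4
        then have "i = j'" using eq canc(4)[of j i j'] lt that(7,9) by metis
        then show ?thesis using 4 that(6,8) by simp
      qed
    qed
    then show ?thesis by simp
  qed
  show "edge_disjoint P"
    unfolding edge_disjoint_def
  proof (intro ballI allI impI, elim conjE)
    fix S T a b assume P: "S \<in> P" "T \<in> P" and ab: "a \<noteq> b" "a \<in> S" "b \<in> S" "a \<in> T" "b \<in> T"
    from mem[OF P(1)] consider
        (f) i j where "S = ?f (i, j)" "i < j" "j < q"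
      | (g) k i j where "S = ?g (k, i, j)" "k < m" "i < j" "j < q" "\<kappa> i j = \<phi> k"
      | (h) k where "S = ?h k" "k \<in> Sp" by blast
    note S = this
    from mem[OF P(2)] consider
        (f) i j where "T = ?f (i, j)" "i < j" "j < q"
      | (g) k i j where "T = ?g (k, i, j)" "k < m" "i < j" "j < q" "\<kappa> i j = \<phi> k"
      | (h) k where "T = ?h k" "k \<in> Sp" by blast
    note T = this
    show "S = T"
    proof (cases rule: S)
      case Sf: f
      show ?thesis
      proof (cases rule: T)
        case f
        show ?thesis unfolding Sf(1) f(1) by (rule ff[OF ab[unfolded Sf(1) f(1)] Sf(2,3) f(2,3)])
      next
        case g
        show ?thesis using fg[OF ab[unfolded Sf(1) g(1)]] ..
      next
        case h
        show ?thesis using fh[OF ab[unfolded Sf(1) h(1)] Sf(2,3) h(2)] ..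
      qed
    next
      case Sg: g
      show ?thesis
      proof (cases rule: T)
        case f
        show ?thesis using fg[OF ab(1,4,5,2,3)[unfolded Sg(1) f(1)]] ..
      next
        case g
        show ?thesis unfolding Sg(1) g(1)
          by (rule gg[OF ab[unfolded Sg(1) g(1)] Sg(3,4) g(3,4) Sg(5) g(5) Sg(2) g(2)])
      next
        case h
        show ?thesis using gh[OF ab[unfolded Sg(1) h(1)] Sg(3,4,5) h(2)] ..
      qed
    next
      case Sh: h
      show ?thesis
      proof (cases rule: T)
        case f
        show ?thesis using fh[OF ab(1,4,5,2,3)[unfolded Sh(1) f(1)] f(2,3) Sh(2)] ..
      next
        case g
        show ?thesis using gh[OF ab(1,4,5,2,3)[unfolded Sh(1) g(1)] g(3,4,5) Sh(2)] ..
      next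
        case h
        show ?thesis using ab unfolding Sh(1) h(1) by auto
      qed
    qed
  qed
  have fin: "finite ?A" "finite ?B" "finite Sp"
    by (auto intro: finite_subset[of _ "{..<q} \<times> {..<q}"] finite_subset[of _ "{..<m} \<times> {..<q} \<times> {..<q}"]
        finite_subset[OF sp(1)])
  have pairs: "i = i' \<and> j = j'" if "i < j" "i' < j'" "i \<in> {i', j'}" "j \<in> {i', j'}" for i j i' j' :: nat
    using that by auto
  have "i = i' \<and> j = j'" if "?f (i, j) = ?f (i', j')" "i < j" "i' < j'" for i j i' j'
  proof -
    have "(Outer, i) \<in> ?f (i', j')" "(Outer, j) \<in> ?f (i', j')" unfolding that(1)[symmetric] by simp_all
    then have "i \<in> {i', j'}" "j \<in> {i', j'}" by simp_all
    then show ?thesis by (rule pairs[OF that(2,3)])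
  qed
  note f_inj = this
  have "inj_on ?f ?A"
  proof (rule inj_onI)
    fix v w assume "v \<in> ?A" "w \<in> ?A" and eq: "?f v = ?f w"
    then obtain i j i' j' where "v = (i, j)" "w = (i', j')" "i < j" "i' < j'" by blast
    then show "v = w" using f_inj[of i j i' j'] eq by simp
  qed
  have "k = k' \<and> i = i' \<and> j = j'" if "?g (k, i, j) = ?g (k', i', j')" "i < j" "i' < j'" for k k' i j i' j' :: nat
  proof -
    have "(Apex, k) \<in> ?g (k', i', j')" "(Inner, i) \<in> ?g (k', i', j')" "(Inner, j) \<in> ?g (k', i', j')"
      unfolding that(1)[symmetric] by simp_all
    then have "k = k'" "i \<in> {i', j'}" "j \<in> {i', j'}" by simp_all
    then show ?thesis using pairs[OF that(2,3)] by blast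
  qed
  note g_inj = this
  have "inj_on ?g ?B"
  proof (rule inj_onI)
    fix v w assume "v \<in> ?B" "w \<in> ?B" and eq: "?g v = ?g w"
    then obtain k i j k' i' j' where "v = (k, i, j)" "w = (k', i', j')" "i < j" "i' < j'" by blast
    then show "v = w" using g_inj[of k i j k' i' j'] eq by simp
  qed
  have "inj_on ?h Sp" by (auto simp: inj_on_def doubleton_eq_iff insert_eq_iff)
  note inj = \<open>inj_on ?f ?A\<close> \<open>inj_on ?g ?B\<close> this
  have "card P = card (?f ` ?A \<union> ?g ` ?B) + card (?h ` Sp)"
    unfolding P_def using fin by (intro card_Un_disjoint) auto
  also have "card (?f ` ?A \<union> ?g ` ?B) = card (?f ` ?A) + card (?g ` ?B)"
    using fin by (intro card_Un_disjoint) auto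
  finally have P: "card P = card ?A + card ?B + card Sp"
    using inj by (simp add: card_image)
  have "?A = (SIGMA j:{..<q}. {..<j})\<inverse>" by auto
  then have "card ?A = (\<Sum>j<q. j)" by (simp add: card_inverse)
  then have A: "2 * card ?A = q * (q - 1)"
    by (cases q) (simp_all add: lessThan_atLeast0 Sum_Ico_nat)
  have "?B = (SIGMA k:{..<m}. {(i, j). i < j \<and> j < q \<and> \<kappa> i j = \<phi> k})" by auto
  then have "card ?B = (\<Sum>k<m. card {(i, j). i < j \<and> j < q \<and> \<kappa> i j = \<phi> k})"
    by (simp add: finite_subset[of _ "{..<q} \<times> {..<q}"] subset_iff)
  then have "2 * card ?B + (\<Sum>k<m. card {i. i < q \<and> \<kappa> i i = \<phi> k}) =
      (\<Sum>k<m. 2 * card {(i, j). i < j \<and> j < q \<and> \<kappa> i j = \<phi> k} + card {i. i < q \<and> \<kappa> i i = \<phi> k})"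
    by (simp add: sum.distrib sum_distrib_left)
  also have "\<dots> = (\<Sum>k<m. q)"
    using card_pairs_of_symbol[OF \<kappa>] \<phi>(2) by (intro sum.cong) auto
  finally show "2 * card P + (\<Sum>k<m. card {i. i < q \<and> \<kappa> i i = \<phi> k}) = q * (q - 1) + m * q + 2 * card Sp"
    using P A by simp
qed

text \<open>
The last conclusion records which edges leave an apex, which is what is needed to
combine the packings of the two cliques of a co-chain graph.
\<close>

lemma clique_gadget:
  fixes E :: "'a set set" and x z \<rho> :: "nat \<Rightarrow> 'a"
  assumes "m \<le> q" "s \<le> m"
    and inj: "inj_on x {..<q}" "inj_on z {..<q}" "inj_on \<rho> {..<m}"
    and disj: "x ` {..<q} \<inter> z ` {..<q} = {}" "x ` {..<q} \<inter> \<rho> ` {..<m} = {}" "z ` {..<q} \<inter> \<rho> ` {..<m} = {}"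
    and cl: "clique (x ` {..<q} \<union> z ` {..<q}) E"
    and ap: "\<And>k i. k < m \<Longrightarrow> i < q \<Longrightarrow> {\<rho> k, z i} \<in> E" "\<And>k. k < s \<Longrightarrow> {\<rho> k, x k} \<in> E"
  obtains P where "P \<subseteq> triangles E" "edge_disjoint P" "2 * card P \<ge> q * (q - 1) + gain q m s"
    "\<And>T. T \<in> P \<Longrightarrow> T \<subseteq> x ` {..<q} \<union> z ` {..<q} \<union> \<rho> ` {..<m}"
    "\<And>T k v. T \<in> P \<Longrightarrow> k < m \<Longrightarrow> \<rho> k \<in> T \<Longrightarrow> v \<in> T \<Longrightarrow>
       v = \<rho> k \<or> v \<in> z ` {..<q} \<or> (k < s \<and> v = x k)"
proof -
  have "\<exists>\<kappa> \<phi> Sp. sym_latin q \<kappa> \<and> inj_on \<phi> {..<m} \<and> \<phi> ` {..<m} \<subseteq> {..<q} \<and> Sp \<subseteq> {..<s} \<and>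
      (\<forall>k\<in>Sp. k < q \<and> \<phi> k = k \<and> \<kappa> k k = k) \<and>
      gain q m s + (\<Sum>k<m. card {i. i < q \<and> \<kappa> i i = \<phi> k}) \<le> m * q + 2 * card Sp"
  proof (cases "odd q")
    case True
    obtain \<kappa> where \<kappa>: "sym_latin q \<kappa>" "\<And>i. i < q \<Longrightarrow> \<kappa> i i = i"
      using sym_latin_idempotent_exists[OF True] by blast
    have "{i. i < q \<and> \<kappa> i i = k} = {k}" if "k < m" for k using \<kappa>(2) that assms(1) by auto
    then have "(\<Sum>k<m. card {i. i < q \<and> \<kappa> i i = k}) = m" by simp
    moreover have "m * (q - 1) + m = m * q" using True by (cases q) auto
    ultimately show ?thesis using True \<kappa> assms(1,2)
      by (intro exI[of _ \<kappa>] exI[of _ "\<lambda>k. k"] exI[of _ "{..<s}"]) (auto simp: gain_def)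
  next
    case False
    show ?thesis
    proof (cases "q = 0")
      case True
      then show ?thesis using assms(1,2) by (auto simp: gain_def sym_latin_def)
    next
      case nz: False
      obtain \<kappa> where \<kappa>: "sym_latin q \<kappa>" "\<And>i. i < q \<Longrightarrow> \<kappa> i i = 0"
        using sym_latin_unipotent_exists[of q] False nz by auto
      have diag: "card {i. i < q \<and> \<kappa> i i = k} = (if k = 0 then q else 0)" for k
      proof (cases "k = 0")
        case True
        then have "{i. i < q \<and> \<kappa> i i = k} = {..<q}" using \<kappa>(2) by auto
        then show ?thesis using True by simp
      qed (use \<kappa>(2) in auto)
      show ?thesis
      proof (cases "m < q")
        case True
        \<comment> \<open>symbol \<open>0\<close> fills the diagonal and colours no edge, so the apexes take the symbols from \<open>1\<close> on\<close>
        have "gain q m s = m * q" using True False by (simp add: gain_def)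
        then show ?thesis using True \<kappa> diag
          by (intro exI[of _ \<kappa>] exI[of _ "Suc"] exI[of _ "{}"]) auto
      next
        case not_less: False
        then have m: "m = q" using assms(1) by simp
        \<comment> \<open>all symbols are taken; apex \<open>0\<close> has the empty colour and can only be special\<close>
        have "(\<Sum>k<m. card {i. i < q \<and> \<kappa> i i = k}) = q"
          using diag m nz by simp
        moreover have "m * (q - 1) + q = m * q" using m nz by (cases q) auto
        moreover have "card ({..<s} \<inter> {0::nat}) = min 1 s" by (cases s) auto
        ultimately show ?thesis using False m \<kappa> nz
          by (intro exI[of _ \<kappa>] exI[of _ "\<lambda>k. k"] exI[of _ "{..<s} \<inter> {0}"]) (auto simp: gain_def)
      qed
    qed
  qed
  then obtain \<kappa> \<phi> Sp where \<kappa>: "sym_latin q \<kappa>" and \<phi>: "inj_on \<phi> {..<m}" "\<phi> ` {..<m} \<subseteq> {..<q}"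
    and Sp: "Sp \<subseteq> {..<s}" "\<And>k. k \<in> Sp \<Longrightarrow> k < q \<and> \<phi> k = k \<and> \<kappa> k k = k"
    and g: "gain q m s + (\<Sum>k<m. card {i. i < q \<and> \<kappa> i i = \<phi> k}) \<le> m * q + 2 * card Sp" by blast
  have Spm: "Sp \<subseteq> {..<m}" using Sp(1) assms(2) by auto
  define P where "P = (\<lambda>(i, j). {(Outer, i), (Outer, j), (Inner, \<kappa> i j)}) ` {(i, j). i < j \<and> j < q}
      \<union> (\<lambda>(k, i, j). {(Apex, k), (Inner, i), (Inner, j)}) ` {(k, i, j). k < m \<and> i < j \<and> j < q \<and> \<kappa> i j = \<phi> k}
      \<union> (\<lambda>k. {(Apex, k), (Inner, k), (Outer, k)}) ` Sp"
  note LP = latin_packing[OF \<kappa> \<phi> Spm Sp(2), folded P_def]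
  define f where "f = (\<lambda>(t, i). case t of Outer \<Rightarrow> x i | Inner \<Rightarrow> z i | Apex \<Rightarrow> \<rho> i)"
  have f: "f (Outer, i) = x i" "f (Inner, i) = z i" "f (Apex, i) = \<rho> i" for i by (simp_all add: f_def)
  define D where "D = {Outer} \<times> {..<q} \<union> {Inner} \<times> {..<q} \<union> {Apex} \<times> {..<m}"
  have ne: "i < q \<Longrightarrow> j < q \<Longrightarrow> x i \<noteq> z j" "i < q \<Longrightarrow> k < m \<Longrightarrow> x i \<noteq> \<rho> k"
    "i < q \<Longrightarrow> k < m \<Longrightarrow> z i \<noteq> \<rho> k" for i j k
    using disj by auto
  have injf: "inj_on f D"
    unfolding D_def using inj ne ne[symmetric] by (auto simp: inj_on_def f)
  have PD: "\<Union>P \<subseteq> D"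
    using sym_latinD(1)[OF \<kappa>] Sp Spm unfolding P_def D_def by auto
  have c3: "card T = 3" if "T \<in> P" for T
    using that unfolding P_def by (auto simp: card_insert_if)
  let ?Q = "(`) f ` P"
  have tri: "?Q \<subseteq> triangles E"
  proof
    fix T' assume "T' \<in> ?Q"
    then obtain T where T: "T \<in> P" "T' = f ` T" by blast
    have "card T' = 3" using T c3 PD injf
      by (metis Sup_le_iff card_image inj_on_subset)
    moreover have "clique T' E"
    proof -
      have cl': "{v, w} \<in> E" if "v \<noteq> w" "v \<in> x ` {..<q} \<union> z ` {..<q}" "w \<in> x ` {..<q} \<union> z ` {..<q}" for v w
        using cl that unfolding clique_def by blast
      have ap': "{z i, \<rho> k} \<in> E" if "k < m" "i < q" for k i using ap(1)[OF that] by (simp add: insert_commute)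
      from T(1) consider
         (1) i j where "i < j" "j < q" "T = {(Outer, i), (Outer, j), (Inner, \<kappa> i j)}"
       | (2) k i j where "k < m" "i < j" "j < q" "T = {(Apex, k), (Inner, i), (Inner, j)}"
       | (3) k where "k \<in> Sp" "T = {(Apex, k), (Inner, k), (Outer, k)}"
        unfolding P_def by auto
      then show ?thesis
      proof cases
        case 1
        then have "T' \<subseteq> x ` {..<q} \<union> z ` {..<q}" using T(2) f sym_latinD(1)[OF \<kappa>, of i j] by auto
        then show ?thesis using cl unfolding clique_def by blast
      next
        case 2
        then show ?thesis unfolding T(2) clique_def
          using ap(1)[of k] ap'[of k] cl'[of "z i" "z j"] by (auto simp: f insert_commute)
      next
        case 3
        then have "k < m" "k < q" "k < s" using Sp Spm by auto
        then show ?thesis unfolding T(2) clique_def 3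
          using ap(1)[of k k] ap(2)[of k] cl'[of "z k" "x k"] by (auto simp: f insert_commute)
      qed
    qed
    ultimately show "T' \<in> triangles E" by (simp add: triangles_def)
  qed
  have "inj_on ((`) f) P"
    using injf PD by (meson Sup_le_iff inj_on_image_eq_iff inj_onI)
  then have "card ?Q = card P" by (rule card_image)
  then have cnt: "2 * card ?Q \<ge> q * (q - 1) + gain q m s"
    using LP(2) g by linarith
  have ed: "edge_disjoint ?Q" by (rule edge_disjoint_image[OF LP(1) injf PD])
  have sub: "T \<subseteq> x ` {..<q} \<union> z ` {..<q} \<union> \<rho> ` {..<m}" if "T \<in> ?Q" for T
  proof -
    have "f ` D \<subseteq> x ` {..<q} \<union> z ` {..<q} \<union> \<rho> ` {..<m}" unfolding D_def by (auto simp: f)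
    then show ?thesis using that PD by blast
  qed
  have st: "v = \<rho> k \<or> v \<in> z ` {..<q} \<or> (k < s \<and> v = x k)"
    if "T' \<in> ?Q" "k < m" "\<rho> k \<in> T'" "v \<in> T'" for T' k v
  proof -
    obtain T where T: "T \<in> P" "T' = f ` T" using \<open>T' \<in> ?Q\<close> by blast
    then have "(Apex, k) \<in> T" using that injf PD
      by (smt (verit, best) D_def SigmaI UnI2 Union_iff f(3) imageE inj_onD insertI1 lessThan_iff subsetD)
    then show ?thesis using T(1) that(4) Sp unfolding T(2) P_def by (auto simp: f)
  qed
  show ?thesis by (rule that[OF tri ed cnt sub st])
qed

section \<open>Co-chain graphs as staircases\<close>

lemma clique_mono: "clique V E \<Longrightarrow> W \<subseteq> V \<Longrightarrow> clique W E"
  by (auto simp: clique_def)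

text \<open>
Rows \<open>i < 2 p\<close> have lengths \<open>r i\<close> and columns \<open>j < 2 q\<close> have heights \<open>k j\<close>, both counted from \<open>0\<close>. Keeping both
functions makes the exchange of the two cliques a mere renaming. A graph can have several layouts,
with different \<open>p\<close> and \<open>q\<close>.
\<close>

locale layout =
  fixes E :: "'a set set" and p q :: nat and c d :: "nat \<Rightarrow> 'a" and r k :: "nat \<Rightarrow> nat"
  assumes inj_c: "inj_on c {..<2 * p}" and inj_d: "inj_on d {..<2 * q}"
    and disj: "c ` {..<2 * p} \<inter> d ` {..<2 * q} = {}"
    and r_le: "i < 2 * p \<Longrightarrow> r i \<le> 2 * q" and k_le: "j < 2 * q \<Longrightarrow> k j \<le> 2 * p"
    and less_r_iff: "i < 2 * p \<Longrightarrow> j < 2 * q \<Longrightarrow> j < r i \<longleftrightarrow> i < k j"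
    and E_eq: "E = [c ` {..<2 * p}]\<^bsup>2\<^esup> \<union> [d ` {..<2 * q}]\<^bsup>2\<^esup>
      \<union> {{c i, d j} |i j. i < 2 * p \<and> j < 2 * q \<and> j < r i}"
begin

lemma swap: "layout E q p d c k r"
proof
  have "{{d i, c j} |i j. i < 2 * q \<and> j < 2 * p \<and> j < k i} = {{c i, d j} |i j. i < 2 * p \<and> j < 2 * q \<and> j < r i}"
  proof (intro set_eqI iffI)
    fix e assume "e \<in> {{d i, c j} |i j. i < 2 * q \<and> j < 2 * p \<and> j < k i}"
    then obtain i j where "e = {c j, d i}" "i < 2 * q" "j < 2 * p" "j < k i" by (auto simp: insert_commute)
    then show "e \<in> {{c i, d j} |i j. i < 2 * p \<and> j < 2 * q \<and> j < r i}" using less_r_iff by blast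
  next
    fix e assume "e \<in> {{c i, d j} |i j. i < 2 * p \<and> j < 2 * q \<and> j < r i}"
    then obtain i j where "e = {d j, c i}" "i < 2 * p" "j < 2 * q" "j < r i" by (auto simp: insert_commute)
    then show "e \<in> {{d i, c j} |i j. i < 2 * q \<and> j < 2 * p \<and> j < k i}" using less_r_iff by blast
  qed
  then show "E = [d ` {..<2 * q}]\<^bsup>2\<^esup> \<union> [c ` {..<2 * p}]\<^bsup>2\<^esup>
      \<union> {{d i, c j} |i j. i < 2 * q \<and> j < 2 * p \<and> j < k i}"
    unfolding E_eq by blast
qed (use inj_c inj_d disj r_le k_le less_r_iff in auto)

lemma r_antimono: "i \<le> i' \<Longrightarrow> i' < 2 * p \<Longrightarrow> r i' \<le> r i"
  using less_r_iff[of i "r i"] less_r_iff[of i' "r i"] r_le[of i']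
  by (cases "r i < r i'") auto

lemma c_eq: "i < 2 * p \<Longrightarrow> i' < 2 * p \<Longrightarrow> c i = c i' \<longleftrightarrow> i = i'"
  using inj_c by (auto dest: inj_onD)

lemma d_eq: "j < 2 * q \<Longrightarrow> j' < 2 * q \<Longrightarrow> d j = d j' \<longleftrightarrow> j = j'"
  using inj_d by (auto dest: inj_onD)

lemma c_neq_d: "i < 2 * p \<Longrightarrow> j < 2 * q \<Longrightarrow> c i \<noteq> d j"
  using disj by auto

lemma fin_graph: "fin_simple_graph (c ` {..<2 * p} \<union> d ` {..<2 * q}) E"
  unfolding fin_simple_graph_def E_eq using c_neq_d
  by (auto simp: nsets_def card_insert_if)

lemma clique_c: "clique (c ` {..<2 * p}) E" and clique_d: "clique (d ` {..<2 * q}) E"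
  unfolding clique_def E_eq by auto

lemma cross_edge: "i < 2 * p \<Longrightarrow> j < 2 * q \<Longrightarrow> j < r i \<Longrightarrow> {c i, d j} \<in> E"
  unfolding E_eq by blast

lemma card_le_nu: "P \<subseteq> triangles E \<Longrightarrow> edge_disjoint P \<Longrightarrow> card P \<le> nu E"
  unfolding nu_def using triangle_packings_finite_nonempty[OF fin_graph] triangle_packingI
  by (intro Max_ge) auto

lemma tau_le_card: "triangle_hitting E F \<Longrightarrow> tau E \<le> card F"
  unfolding tau_def using triangle_hittings_finite_nonempty[OF fin_graph]
  by (intro Min_le) auto

lemma tau_le_cut:
  assumes A: "A \<subseteq> {..<2 * p}" and B: "B \<subseteq> {..<2 * q}"
  shows "tau E \<le> (card A choose 2) + ((2 * p - card A) choose 2) + (card B choose 2)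
    + ((2 * q - card B) choose 2) + card {(i, j). i < 2 * p \<and> j < 2 * q \<and> j < r i \<and> (i \<in> A \<longleftrightarrow> j \<in> B)}"
proof -
  define A' B' where "A' = {..<2 * p} - A" and "B' = {..<2 * q} - B"
  define X Y where "X = c ` A \<union> d ` B" and "Y = c ` A' \<union> d ` B'"
  define D where "D = {(i, j). i < 2 * p \<and> j < 2 * q \<and> j < r i \<and> (i \<in> A \<longleftrightarrow> j \<in> B)}"
  have V: "c ` {..<2 * p} \<union> d ` {..<2 * q} = X \<union> Y"
    using A B unfolding X_def Y_def A'_def B'_def by auto
  have fin: "finite A" "finite B" "finite A'" "finite B'" "finite D"
    using A B finite_subset[of D "{..<2 * p} \<times> {..<2 * q}"]
    by (auto simp: A'_def B'_def D_def intro: finite_subset)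
  define F where "F = {e \<in> E. e \<subseteq> X \<or> e \<subseteq> Y}"
  have "triangles (E - F) = {}"
  proof (rule ccontr)
    assume "triangles (E - F) \<noteq> {}"
    then obtain T where T: "card T = 3" "clique T (E - F)" by (auto simp: triangles_def)
    then obtain u v w where uvw: "T = {u, v, w}" "u \<noteq> v" "v \<noteq> w" "u \<noteq> w" by (auto simp: card_3_iff)
    have e: "{u, v} \<in> E - F" "{v, w} \<in> E - F" "{u, w} \<in> E - F"
      using T(2) uvw unfolding clique_def by auto
    have "E \<subseteq> [X \<union> Y]\<^bsup>2\<^esup>" using fin_graph unfolding fin_simple_graph_def V by simp
    then have "u \<in> X \<union> Y" "v \<in> X \<union> Y" "w \<in> X \<union> Y" using e by (auto simp: nsets_def)
    then show False using e unfolding F_def by auto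
  qed
  then have "tau E \<le> card F"
    by (intro tau_le_card) (auto simp: triangle_hitting_def F_def)
  also have "F \<subseteq> [c ` A]\<^bsup>2\<^esup> \<union> [c ` A']\<^bsup>2\<^esup> \<union> [d ` B]\<^bsup>2\<^esup> \<union> [d ` B']\<^bsup>2\<^esup> \<union> (\<lambda>(i, j). {c i, d j}) ` D"
  proof
    fix e assume "e \<in> F"
    then have e: "e \<in> E" "e \<subseteq> X \<or> e \<subseteq> Y" by (auto simp: F_def)
    have A': "A' \<subseteq> {..<2 * p}" and B': "B' \<subseteq> {..<2 * q}" by (auto simp: A'_def B'_def)
    have side: "c i \<in> X \<longleftrightarrow> i \<in> A" "c i \<in> Y \<longleftrightarrow> i \<notin> A" if "i < 2 * p" for i
    proof -
      have "c i \<in> c ` A \<longleftrightarrow> i \<in> A" "c i \<in> c ` A' \<longleftrightarrow> i \<in> A'" "c i \<notin> d ` {..<2 * q}"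
        using inj_on_image_mem_iff[OF inj_c] A A' that disj by auto
      then show "c i \<in> X \<longleftrightarrow> i \<in> A" "c i \<in> Y \<longleftrightarrow> i \<notin> A"
        using that B B' unfolding X_def Y_def by (auto simp: A'_def)
    qed
    have sided: "d j \<in> X \<longleftrightarrow> j \<in> B" "d j \<in> Y \<longleftrightarrow> j \<notin> B" if "j < 2 * q" for j
    proof -
      have "d j \<in> d ` B \<longleftrightarrow> j \<in> B" "d j \<in> d ` B' \<longleftrightarrow> j \<in> B'" "d j \<notin> c ` {..<2 * p}"
        using inj_on_image_mem_iff[OF inj_d] B B' that disj by auto
      then show "d j \<in> X \<longleftrightarrow> j \<in> B" "d j \<in> Y \<longleftrightarrow> j \<notin> B"
        using that A A' unfolding X_def Y_def by (auto simp: B'_def)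
    qed
    from e(1) consider "e \<in> [c ` {..<2 * p}]\<^bsup>2\<^esup>" | "e \<in> [d ` {..<2 * q}]\<^bsup>2\<^esup>"
      | i j where "e = {c i, d j}" "i < 2 * p" "j < 2 * q" "j < r i" unfolding E_eq by blast
    then show "e \<in> [c ` A]\<^bsup>2\<^esup> \<union> [c ` A']\<^bsup>2\<^esup> \<union> [d ` B]\<^bsup>2\<^esup> \<union> [d ` B']\<^bsup>2\<^esup> \<union> (\<lambda>(i, j). {c i, d j}) ` D"
    proof cases
      case 1
      then have "e \<subseteq> c ` {..<2 * p}" "finite e" "card e = 2" by (auto simp: nsets_def)
      moreover have "e \<subseteq> c ` A \<or> e \<subseteq> c ` A'"
      proof -
        have "v \<in> c ` A" if "v \<in> e" "v \<in> X" for v using that \<open>e \<subseteq> c ` {..<2 * p}\<close> side by blast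
        moreover have "v \<in> c ` A'" if "v \<in> e" "v \<in> Y" for v
          using that \<open>e \<subseteq> c ` {..<2 * p}\<close> side unfolding A'_def by blast
        ultimately show ?thesis using e(2) by blast
      qed
      ultimately show ?thesis by (auto simp: nsets_def)
    next
      case 2
      then have "e \<subseteq> d ` {..<2 * q}" "finite e" "card e = 2" by (auto simp: nsets_def)
      moreover have "e \<subseteq> d ` B \<or> e \<subseteq> d ` B'"
      proof -
        have "v \<in> d ` B" if "v \<in> e" "v \<in> X" for v using that \<open>e \<subseteq> d ` {..<2 * q}\<close> sided by blast
        moreover have "v \<in> d ` B'" if "v \<in> e" "v \<in> Y" for v
          using that \<open>e \<subseteq> d ` {..<2 * q}\<close> sided unfolding B'_def by blast
        ultimately show ?thesis using e(2) by blast
      qed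
      ultimately show ?thesis by (auto simp: nsets_def)
    next
      case 3
      then have "(i, j) \<in> D" using e(2) side sided unfolding D_def by auto
      then show ?thesis using 3(1) by auto
    qed
  qed
  then have "card F \<le> card ([c ` A]\<^bsup>2\<^esup> \<union> [c ` A']\<^bsup>2\<^esup> \<union> [d ` B]\<^bsup>2\<^esup> \<union> [d ` B']\<^bsup>2\<^esup> \<union> (\<lambda>(i, j). {c i, d j}) ` D)"
    using fin by (intro card_mono) (auto intro!: finite_imp_finite_nsets)
  also have "\<dots> \<le> card ([c ` A]\<^bsup>2\<^esup>) + card ([c ` A']\<^bsup>2\<^esup>) + card ([d ` B]\<^bsup>2\<^esup>) + card ([d ` B']\<^bsup>2\<^esup>)
      + card ((\<lambda>(i, j). {c i, d j}) ` D)"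
    by (intro order.trans[OF card_Un_le] add_mono order.refl)
  also have "\<dots> \<le> (card A choose 2) + (card A' choose 2) + (card B choose 2) + (card B' choose 2) + card D"
  proof -
    have "card (c ` A) = card A" "card (c ` A') = card A'" "card (d ` B) = card B" "card (d ` B') = card B'"
      using inj_c inj_d A B unfolding A'_def B'_def by (auto intro!: card_image intro: inj_on_subset)
    then show ?thesis using fin card_image_le[OF fin(5)] by (simp add: card_nsets add_mono)
  qed
  finally have "tau E \<le> \<dots>" .
  moreover have "card A' = 2 * p - card A" "card B' = 2 * q - card B"
    using A B fin unfolding A'_def B'_def by (simp_all add: card_Diff_subset)
  ultimately show ?thesis unfolding D_def by simp
qed

text \<open>
The rows \<open>i < m\<close> are apexes over the window of columns \<open>t..<t + q\<close>, the columns \<open>j < n\<close> over the window of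
rows \<open>t'..<t' + p\<close>; \<open>x\<close> and \<open>x'\<close> enumerate the remaining halves in such a way that special apexes meet
their partners. A triangle of the first packing has at most one vertex in the clique of the rows and one of the
second at most one vertex in the clique of the columns, so a common edge would be a cell; the
last assumption says that no cell is used twice.
\<close>

lemma two_nu_ge:
  assumes rows: "m \<le> q" "t \<le> q" "\<And>i. i < m \<Longrightarrow> i < 2 * p \<and> t + q \<le> r i" "s \<le> m"
    and x: "inj_on x {..<q}" "x ` {..<q} \<subseteq> {..<2 * q} - {t..<t + q}" "\<And>i. i < s \<Longrightarrow> x i < r i"
    and columns: "n \<le> p" "t' \<le> p" "\<And>j. j < n \<Longrightarrow> j < 2 * q \<and> t' + p \<le> k j" "s' \<le> n"
    and x': "inj_on x' {..<p}" "x' ` {..<p} \<subseteq> {..<2 * p} - {t'..<t' + p}" "\<And>j. j < s' \<Longrightarrow> x' j < k j"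
    and compatible: "\<And>i j. i < m \<Longrightarrow> j < n \<Longrightarrow> j \<in> {t..<t + q} \<or> i < s \<and> j = x i \<Longrightarrow>
      i \<in> {t'..<t' + p} \<or> j < s' \<and> i = x' j \<Longrightarrow> False"
  shows "p * (p - 1) + q * (q - 1) + gain q m s + gain p n s' \<le> 2 * nu E"
proof -
  have halves: "(d \<circ> x) ` {..<q} \<union> (\<lambda>i. d (t + i)) ` {..<q} \<subseteq> d ` {..<2 * q}"
      "(c \<circ> x') ` {..<p} \<union> (\<lambda>i. c (t' + i)) ` {..<p} \<subseteq> c ` {..<2 * p}"
    using x(2) x'(2) rows(2) columns(2) by auto
  have xl: "x i < 2 * q" "x i \<notin> {t..<t + q}" if "i < q" for i using x(2) that by blast+
  have xl': "x' i < 2 * p" "x' i \<notin> {t'..<t' + p}" if "i < p" for i using x'(2) that by blast+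
  have img: "(\<lambda>i. d (t + i)) ` {..<q} = d ` {t..<t + q}" "(\<lambda>i. c (t' + i)) ` {..<p} = c ` {t'..<t' + p}"
    by (auto simp: image_iff Bex_def) (metis add_less_cancel_left le_add_diff_inverse)+
  have r: "i < 2 * p" "t + q \<le> r i" if "i < m" for i using rows(3)[OF that] by auto
  have k: "j < 2 * q" "t' + p \<le> k j" if "j < n" for j using columns(3)[OF that] by auto
  have window: "{t..<t + q} \<subseteq> {..<2 * q}" "{t'..<t' + p} \<subseteq> {..<2 * p}"
    using rows(2) columns(2) by auto
  have low: "c ` {..<m} \<subseteq> c ` {..<2 * p}" "d ` {..<n} \<subseteq> d ` {..<2 * q}"
    using r(1) k(1) by (intro image_mono subsetI; simp)+
  obtain P1 where P1: "P1 \<subseteq> triangles E" "edge_disjoint P1" "2 * card P1 \<ge> q * (q - 1) + gain q m s"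
    "\<And>T. T \<in> P1 \<Longrightarrow> T \<subseteq> (d \<circ> x) ` {..<q} \<union> (\<lambda>i. d (t + i)) ` {..<q} \<union> c ` {..<m}"
    "\<And>T i v. T \<in> P1 \<Longrightarrow> i < m \<Longrightarrow> c i \<in> T \<Longrightarrow> v \<in> T \<Longrightarrow>
       v = c i \<or> v \<in> (\<lambda>i. d (t + i)) ` {..<q} \<or> (i < s \<and> v = (d \<circ> x) i)"
  proof (rule clique_gadget[where x = "d \<circ> x" and z = "\<lambda>i. d (t + i)" and \<rho> = c])
    show "inj_on (d \<circ> x) {..<q}" using x xl inj_d by (auto intro!: comp_inj_on intro: inj_on_subset)
    show "inj_on (\<lambda>i. d (t + i)) {..<q}" using rows(2) d_eq by (auto intro!: inj_onI)
    show "inj_on c {..<m}" using r(1) by (intro inj_on_subset[OF inj_c] subsetI) simp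
    show "(d \<circ> x) ` {..<q} \<inter> (\<lambda>i. d (t + i)) ` {..<q} = {}"
      unfolding img using xl d_eq rows(2) by fastforce
    show "(d \<circ> x) ` {..<q} \<inter> c ` {..<m} = {}" "(\<lambda>i. d (t + i)) ` {..<q} \<inter> c ` {..<m} = {}"
      using halves(1) low(1) disj by blast+
    show "clique ((d \<circ> x) ` {..<q} \<union> (\<lambda>i. d (t + i)) ` {..<q}) E"
      using clique_mono[OF clique_d halves(1)] .
    show "{c i, d (t + j)} \<in> E" if "i < m" "j < q" for i j
      using r[OF that(1)] that rows(2) by (intro cross_edge) auto
    show "{c i, (d \<circ> x) i} \<in> E" if "i < s" for i
      using that rows(1,4) r(1)[of i] x(3) xl by (auto intro!: cross_edge)
  qed (use rows in auto)
  obtain P2 where P2: "P2 \<subseteq> triangles E" "edge_disjoint P2" "2 * card P2 \<ge> p * (p - 1) + gain p n s'"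
    "\<And>T. T \<in> P2 \<Longrightarrow> T \<subseteq> (c \<circ> x') ` {..<p} \<union> (\<lambda>i. c (t' + i)) ` {..<p} \<union> d ` {..<n}"
    "\<And>T j v. T \<in> P2 \<Longrightarrow> j < n \<Longrightarrow> d j \<in> T \<Longrightarrow> v \<in> T \<Longrightarrow>
       v = d j \<or> v \<in> (\<lambda>i. c (t' + i)) ` {..<p} \<or> (j < s' \<and> v = (c \<circ> x') j)"
  proof (rule clique_gadget[where x = "c \<circ> x'" and z = "\<lambda>i. c (t' + i)" and \<rho> = d])
    show "inj_on (c \<circ> x') {..<p}" using x' xl' inj_c by (auto intro!: comp_inj_on intro: inj_on_subset)
    show "inj_on (\<lambda>i. c (t' + i)) {..<p}" using columns(2) c_eq by (auto intro!: inj_onI)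
    show "inj_on d {..<n}" using k(1) by (intro inj_on_subset[OF inj_d] subsetI) simp
    show "(c \<circ> x') ` {..<p} \<inter> (\<lambda>i. c (t' + i)) ` {..<p} = {}"
      unfolding img using xl' c_eq columns(2) by fastforce
    show "(c \<circ> x') ` {..<p} \<inter> d ` {..<n} = {}" "(\<lambda>i. c (t' + i)) ` {..<p} \<inter> d ` {..<n} = {}"
      using halves(2) low(2) disj by blast+
    show "clique ((c \<circ> x') ` {..<p} \<union> (\<lambda>i. c (t' + i)) ` {..<p}) E"
      using clique_mono[OF clique_c halves(2)] .
    show "{d j, c (t' + i)} \<in> E" if "j < n" "i < p" for i j
      using k[OF that(1)] that columns(2) cross_edge[of "t' + i" j] less_r_iff[of "t' + i" j]
      by (simp add: insert_commute)
    show "{d j, (c \<circ> x') j} \<in> E" if "j < s'" for j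
      using that columns(1,4) k(1)[of j] x'(3)[OF that] xl'[of j] cross_edge[of "x' j" j] less_r_iff[of "x' j" j]
      by (simp add: insert_commute)
  qed (use columns in auto)
  have apart: False if T: "S \<in> P1" "T \<in> P2" "a \<noteq> b" "a \<in> S" "b \<in> S" "a \<in> T" "b \<in> T" for S T a b
  proof -
    have one_c: "\<not> (v \<in> c ` {..<2 * p} \<and> w \<in> c ` {..<2 * p})" if vw: "v \<noteq> w" "v \<in> S" "w \<in> S" for v w
    proof
      assume *: "v \<in> c ` {..<2 * p} \<and> w \<in> c ` {..<2 * p}"
      then have "v \<notin> d ` {..<2 * q}" "w \<notin> d ` {..<2 * q}" using disj by auto
      then obtain i where i: "v = c i" "i < m" using P1(4)[OF T(1)] vw halves(1) by blast
      have "w \<in> (\<lambda>i. d (t + i)) ` {..<q} \<or> (i < s \<and> w = (d \<circ> x) i)"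
        using P1(5)[OF T(1), of i w] vw i by auto
      then have "w \<in> d ` {..<2 * q}" using halves(1) rows(1,4) i(2) xl by auto
      then show False using \<open>w \<notin> d ` {..<2 * q}\<close> by contradiction
    qed
    have one_d: "\<not> (v \<in> d ` {..<2 * q} \<and> w \<in> d ` {..<2 * q})" if vw: "v \<noteq> w" "v \<in> T" "w \<in> T" for v w
    proof
      assume *: "v \<in> d ` {..<2 * q} \<and> w \<in> d ` {..<2 * q}"
      then have "v \<notin> c ` {..<2 * p}" "w \<notin> c ` {..<2 * p}" using disj by auto
      then obtain j where j: "v = d j" "j < n" using P2(4)[OF T(2)] vw halves(2) by blast
      have "w \<in> (\<lambda>i. c (t' + i)) ` {..<p} \<or> (j < s' \<and> w = (c \<circ> x') j)"
        using P2(5)[OF T(2), of j w] vw j by auto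
      then have "w \<in> c ` {..<2 * p}" using halves(2) columns(1,4) j(2) xl' by auto
      then show False using \<open>w \<notin> c ` {..<2 * p}\<close> by contradiction
    qed
    have main: False if v: "v \<in> S" "v \<in> T" "v \<in> c ` {..<2 * p}" and w: "w \<in> S" "w \<in> T" "w \<in> d ` {..<2 * q}"
      for v w
    proof -
      have "v \<notin> d ` {..<2 * q}" "w \<notin> c ` {..<2 * p}" using v w disj by auto
      then have "v \<in> c ` {..<m}" "w \<in> d ` {..<n}"
        using subsetD[OF P1(4)[OF T(1)] v(1)] subsetD[OF P2(4)[OF T(2)] w(2)] halves by blast+
      then obtain i j where i: "v = c i" "i < m" and j: "w = d j" "j < n" by blast
      have vw: "v \<noteq> w" using \<open>v \<notin> d ` {..<2 * q}\<close> w(3) by auto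
      have "w \<in> d ` {t..<t + q} \<or> (i < s \<and> w = d (x i))"
        using P1(5)[OF T(1) i(2), of w] i v w vw unfolding img by auto
      then have "j \<in> {t..<t + q} \<or> i < s \<and> j = x i"
        using j k(1)[of j] rows d_eq[of j "x i"] xl[of i] inj_on_image_mem_iff[OF inj_d _ window(1), of j]
        by auto
      moreover have "v \<in> c ` {t'..<t' + p} \<or> (j < s' \<and> v = c (x' j))"
        using P2(5)[OF T(2) j(2), of v] j v w vw unfolding img by auto
      then have "i \<in> {t'..<t' + p} \<or> j < s' \<and> i = x' j"
        using i r(1)[of i] columns c_eq[of i "x' j"] xl'[of j] inj_on_image_mem_iff[OF inj_c _ window(2), of i]
        by auto
      ultimately show False using compatible i j by blast
    qed
    have "S \<subseteq> c ` {..<2 * p} \<union> d ` {..<2 * q}"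
      using P1(4)[OF T(1)] halves(1) low(1) by blast
    then have "a \<in> c ` {..<2 * p} \<or> a \<in> d ` {..<2 * q}" "b \<in> c ` {..<2 * p} \<or> b \<in> d ` {..<2 * q}"
      using T(4,5) by blast+
    then show False
      using one_c[OF T(3,4,5)] one_d[OF T(3,6,7)] main[OF T(4,6) _ T(5,7)] main[OF T(5,7) _ T(4,6)] by blast
  qed
  have tri3: "card T = 3" if "T \<in> triangles E" for T using that by (simp add: triangles_def)
  have "edge_disjoint (P1 \<union> P2)"
    unfolding edge_disjoint_def
  proof (intro ballI allI impI, elim conjE)
    fix S T a b assume "S \<in> P1 \<union> P2" "T \<in> P1 \<union> P2" "a \<noteq> b" "a \<in> S" "b \<in> S" "a \<in> T" "b \<in> T"
    then show "S = T"
      using P1(2) P2(2) apart[of S T a b] apart[of T S a b] unfolding edge_disjoint_def by blast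
  qed
  then have "card (P1 \<union> P2) \<le> nu E" using P1(1) P2(1) by (intro card_le_nu) auto
  moreover have "P1 \<inter> P2 = {}"
  proof (rule ccontr)
    assume "P1 \<inter> P2 \<noteq> {}"
    then obtain T where T: "T \<in> P1" "T \<in> P2" by blast
    then obtain a b e where "T = {a, b, e}" "a \<noteq> b" using tri3 P1(1) by (metis card_3_iff subsetD)
    then show False using apart[OF T, of a b] by auto
  qed
  moreover have "finite P1" "finite P2"
  proof -
    have "triangles E \<subseteq> Pow (c ` {..<2 * p} \<union> d ` {..<2 * q})"
    proof
      fix T assume "T \<in> triangles E"
      then obtain u v w where "T = {u, v, w}" "{u, v} \<in> E" "{u, w} \<in> E"
        unfolding triangles_def clique_def by (auto simp: card_3_iff)
      then show "T \<in> Pow (c ` {..<2 * p} \<union> d ` {..<2 * q})"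
        using fin_graph unfolding fin_simple_graph_def nsets_def by auto
    qed
    then have "finite (triangles E)" by (rule finite_subset) auto
    then show "finite P1" "finite P2" using P1(1) P2(1) by (auto intro: finite_subset)
  qed
  ultimately show ?thesis using P1(3) P2(3) by (simp add: card_Un_disjoint)
qed

end

lemma gain_ge: "m \<le> q \<Longrightarrow> s \<le> m \<Longrightarrow> s \<le> 1 \<Longrightarrow> m * (q - 1) + s \<le> gain q m s"
  by (cases q) (auto simp: gain_def)

lemma choose_two_balanced:
  assumes "e \<le> p"
  shows "((p + e) choose 2) + ((p - e) choose 2) = p * (p - 1) + e\<^sup>2"
proof -
  have two: "2 * (n choose 2) = n * (n - 1)" for n :: nat
    by (cases n) (simp_all add: choose_two)
  obtain f where p: "p = e + f" using assms le_Suc_ex by blast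
  have "2 * (((p + e) choose 2) + ((p - e) choose 2)) = (p + e) * (p + e - 1) + (p - e) * (p - e - 1)"
    by (simp add: distrib_left two)
  also have "\<dots> = 2 * (p * (p - 1) + e\<^sup>2)"
    unfolding p by (cases e; cases f) (auto simp: power2_eq_square algebra_simps)
  finally show ?thesis by simp
qed

context layout
begin

lemma k_antimono: "j \<le> j' \<Longrightarrow> j' < 2 * q \<Longrightarrow> k j' \<le> k j"
  by (rule layout.r_antimono[OF swap])

text \<open>
The rows \<open>i < m\<close> lie before the window of rows \<open>t..<t + p\<close>, so the two rectangles are disjoint. The only special apexes
are the row \<open>0\<close> and the column \<open>0\<close>, with partners just behind the windows. In this form each
apex counts for \<open>q - 1\<close> (or \<open>p - 1\<close>) cells whatever the parity, and a special one
makes up for at least one lost cell.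
\<close>

lemma rows_and_columns:
  assumes rows: "m \<le> q" "\<And>i. i < m \<Longrightarrow> i < 2 * p \<and> q \<le> r i"
    and s: "s \<le> m" "s \<le> 1" "s = 1 \<Longrightarrow> q < r 0"
    and columns: "n \<le> p" "\<And>j. j < n \<Longrightarrow> j < 2 * q \<and> t + p \<le> k j" "t \<le> p"
    and s': "s' \<le> n" "s' \<le> 1" "s' = 1 \<Longrightarrow> t + p < k 0"
    and sep: "m \<le> t \<or> n = 0"
  shows "p * (p - 1) + q * (q - 1) + (m * (q - 1) + s) + (n * (p - 1) + s') \<le> 2 * nu E"
proof -
  define x' where "x' i = (if t + p + i < 2 * p then t + p + i else t + i - p)" for i
  have "p * (p - 1) + q * (q - 1) + gain q m s + gain p n s' \<le> 2 * nu E"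
  proof (rule two_nu_ge[where t = 0 and x = "\<lambda>i. q + i" and x' = x' and t' = t])
    show "inj_on x' {..<p}" by (auto simp: inj_on_def x'_def split: if_splits)
    show "x' ` {..<p} \<subseteq> {..<2 * p} - {t..<t + p}"
      using columns(3) by (auto simp: x'_def split: if_splits)
    have k0: "t < p" if "s' = 1"
      using s' columns(2)[of 0] k_le[of 0] that by (cases "t = p") auto
    show "x' j < k j" if "j < s'" for j
    proof -
      have "j = 0" "s' = 1" using that s'(2) by auto
      then show ?thesis using s'(3) k0 by (simp add: x'_def)
    qed
    show "q + i < r i" if "i < s" for i
    proof -
      have "i = 0" "s = 1" using that s(2) by auto
      then show ?thesis using s(3) by simp
    qed
    show False if "i < m" "j < n" "j \<in> {0..<0 + q} \<or> i < s \<and> j = q + i"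
      "i \<in> {t..<t + p} \<or> j < s' \<and> i = x' j" for i j
      using that sep s' k0 by (auto simp: x'_def)
  qed (use assms in \<open>auto simp: inj_on_def\<close>)
  then show ?thesis
    using gain_ge[OF rows(1) s(1,2)] gain_ge[OF columns(1) s'(1,2)] by linarith
qed

text \<open>
The halving cut with \<open>e\<close> and \<open>f\<close> vertices moved across, when the first halves of the cliques are on
the same side.
\<close>

lemma tau_le_same_side:
  assumes "e \<le> p" "f \<le> q"
  shows "tau E \<le> p * (p - 1) + q * (q - 1) + e\<^sup>2 + f\<^sup>2
    + card {(i, j). i < 2 * p \<and> j < r i \<and> (i < p - e \<longleftrightarrow> j < q - f)}"
proof -
  have "{(i, j). i < 2 * p \<and> j < 2 * q \<and> j < r i \<and> (i \<in> {..<p - e} \<longleftrightarrow> j \<in> {..<q - f})} =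
      {(i, j). i < 2 * p \<and> j < r i \<and> (i < p - e \<longleftrightarrow> j < q - f)}" (is "?L = ?R")
    using r_le by fastforce
  moreover have "tau E \<le> ((p - e) choose 2) + ((p + e) choose 2) + ((q - f) choose 2) + ((q + f) choose 2) + card ?L"
  proof -
    have "{..<p - e} \<subseteq> {..<2 * p}" "{..<q - f} \<subseteq> {..<2 * q}" "2 * p - (p - e) = p + e" "2 * q - (q - f) = q + f"
      using assms by auto
    then show ?thesis using tau_le_cut[of "{..<p - e}" "{..<q - f}"] by (simp only: card_lessThan)
  qed
  ultimately have "tau E \<le> ((p - e) choose 2) + ((p + e) choose 2) + ((q - f) choose 2) + ((q + f) choose 2) + card ?R"
    by simp
  then show ?thesis using choose_two_balanced[OF assms(1)] choose_two_balanced[OF assms(2)] by linarith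
qed

text \<open>
The halving cut with \<open>e\<close> and \<open>f\<close> vertices moved across, when the first half of one clique is together with
the second half of the other.
\<close>

lemma tau_le_opposite_sides:
  assumes "e \<le> p" "f \<le> q"
  shows "tau E \<le> p * (p - 1) + q * (q - 1) + e\<^sup>2 + f\<^sup>2 + (\<Sum>s\<in>{e..<p}. r (p + s)) + (\<Sum>t\<in>{f..<q}. k (q + t))"
proof -
  let ?D = "{(i, j). i < 2 * p \<and> j < 2 * q \<and> j < r i \<and> (i \<in> {..<p + e} \<longleftrightarrow> j \<in> {q + f..<2 * q})}"
  let ?A = "SIGMA s:{e..<p}. {..<r (p + s)}"
  let ?B = "SIGMA t:{f..<q}. {..<k (q + t)}"
  have "?D \<subseteq> (\<lambda>(s, j). (p + s, j)) ` ?A \<union> (\<lambda>(t, i). (i, q + t)) ` ?B"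
  proof (clarify)
    fix i j assume ij: "i < 2 * p" "j < 2 * q" "j < r i" "i \<in> {..<p + e} \<longleftrightarrow> j \<in> {q + f..<2 * q}"
      and nB: "(i, j) \<notin> (\<lambda>(t, i). (i, q + t)) ` ?B"
    have "\<not> (i < p + e \<and> q + f \<le> j)"
    proof
      assume *: "i < p + e \<and> q + f \<le> j"
      then have "(j - q, i) \<in> ?B" "j = q + (j - q)" using ij less_r_iff[of i j] by auto
      then show False using nB by (metis (mono_tags, lifting) case_prod_conv imageI)
    qed
    then have "p + e \<le> i" using ij by auto
    then have "(i - p, j) \<in> ?A" "i = p + (i - p)" using ij by auto
    then show "(i, j) \<in> (\<lambda>(s, j). (p + s, j)) ` ?A" by (metis (mono_tags, lifting) case_prod_conv imageI)
  qed
  then have "card ?D \<le> card ((\<lambda>(s, j). (p + s, j)) ` ?A \<union> (\<lambda>(t, i). (i, q + t)) ` ?B)"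
    by (intro card_mono) auto
  also have "\<dots> \<le> card ((\<lambda>(s, j). (p + s, j)) ` ?A) + card ((\<lambda>(t, i). (i, q + t)) ` ?B)"
    by (rule card_Un_le)
  also have "\<dots> \<le> card ?A + card ?B"
    by (intro add_mono card_image_le) auto
  finally have D: "card ?D \<le> (\<Sum>s\<in>{e..<p}. r (p + s)) + (\<Sum>t\<in>{f..<q}. k (q + t))" by simp
  have "2 * p - (p + e) = p - e" "card {q + f..<2 * q} = q - f" "2 * q - (q - f) = q + f"
    using assms by auto
  moreover have "tau E \<le> ((p + e) choose 2) + ((p - e) choose 2) + ((q - f) choose 2) + ((q + f) choose 2) + card ?D"
  proof -
    have "{..<p + e} \<subseteq> {..<2 * p}" "{q + f..<2 * q} \<subseteq> {..<2 * q}" using assms by auto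
    from tau_le_cut[OF this] show ?thesis
      by (simp only: card_lessThan \<open>2 * p - (p + e) = p - e\<close>
          \<open>card {q + f..<2 * q} = q - f\<close> \<open>2 * q - (q - f) = q + f\<close>)
  qed
  ultimately show ?thesis
    using D choose_two_balanced[of e p] choose_two_balanced[of f q] assms by linarith
qed

text \<open>
The columns \<open>j < 2 m\<close> are adjacent to everything, hence they may be counted among the rows, in front
of all of them.
\<close>

lemma shift:
  assumes "m \<le> q" and univ: "\<And>i. i < 2 * p \<Longrightarrow> 2 * m \<le> r i"
  shows "\<exists>c' d'. layout E (p + m) (q - m) c' d'
    (\<lambda>i. if i < 2 * m then 2 * (q - m) else r (i - 2 * m) - 2 * m) (\<lambda>j. k (j + 2 * m) + 2 * m)"
proof (intro exI)
  define c' where "c' i = (if i < 2 * m then d i else c (i - 2 * m))" for i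
  define d' where "d' j = d (j + 2 * m)" for j
  define D1 where "D1 = d ` {..<2 * m}"
  define D2 where "D2 = d ` {2 * m..<2 * q}"
  define C where "C = c ` {..<2 * p}"
  have D: "d ` {..<2 * q} = D1 \<union> D2"
    unfolding D1_def D2_def using assms(1) by (auto simp flip: image_Un simp: ivl_disj_un)
  have dis: "D1 \<inter> D2 = {}" "C \<inter> D1 = {}" "C \<inter> D2 = {}"
    using disj d_eq assms(1) D unfolding C_def D1_def D2_def by (fastforce, blast+)
  have c': "c' ` {..<2 * (p + m)} = D1 \<union> C"
  proof -
    have "{..<2 * (p + m)} = {..<2 * m} \<union> (\<lambda>i. i + 2 * m) ` {..<2 * p}"
    proof (intro set_eqI iffI)
      fix i assume "i \<in> {..<2 * (p + m)}"
      then show "i \<in> {..<2 * m} \<union> (\<lambda>i. i + 2 * m) ` {..<2 * p}"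
        by (cases "i < 2 * m") (auto intro!: image_eqI[of _ _ "i - 2 * m"])
    qed auto
    moreover have "c' ` {..<2 * m} = D1" unfolding D1_def c'_def by (intro image_cong) auto
    moreover have "c' ` (\<lambda>i. i + 2 * m) ` {..<2 * p} = C"
      unfolding C_def c'_def image_image by (intro image_cong) auto
    ultimately show ?thesis by (simp add: image_Un)
  qed
  have d': "d' ` {..<2 * (q - m)} = D2"
  proof -
    have "(\<lambda>j. j + 2 * m) ` {..<2 * (q - m)} = {2 * m..<2 * q}"
    proof (intro set_eqI iffI)
      fix i assume "i \<in> {2 * m..<2 * q}"
      then show "i \<in> (\<lambda>j. j + 2 * m) ` {..<2 * (q - m)}"
        by (auto intro!: image_eqI[of _ _ "i - 2 * m"])
    qed (use assms(1) in auto)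
    then show ?thesis unfolding D2_def d'_def by (metis image_image)
  qed
  have un: "[A \<union> B]\<^bsup>2\<^esup> = [A]\<^bsup>2\<^esup> \<union> [B]\<^bsup>2\<^esup> \<union> {{a, b} |a b. a \<in> A \<and> b \<in> B}" if "A \<inter> B = {}" for A B :: "'a set"
  proof (intro set_eqI iffI)
    fix e assume "e \<in> [A \<union> B]\<^bsup>2\<^esup>"
    then obtain a b where e: "e = {a, b}" "a \<noteq> b" "a \<in> A \<union> B" "b \<in> A \<union> B" by (auto simp: nsets_def card_2_iff)
    then have "e = {b, a}" by auto
    then show "e \<in> [A]\<^bsup>2\<^esup> \<union> [B]\<^bsup>2\<^esup> \<union> {{a, b} |a b. a \<in> A \<and> b \<in> B}" using e by auto
  next
    fix e assume "e \<in> [A]\<^bsup>2\<^esup> \<union> [B]\<^bsup>2\<^esup> \<union> {{a, b} |a b. a \<in> A \<and> b \<in> B}"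
    then show "e \<in> [A \<union> B]\<^bsup>2\<^esup>" using that by (auto simp: nsets_def card_insert_if)
  qed
  let ?r = "\<lambda>i. if i < 2 * m then 2 * (q - m) else r (i - 2 * m) - 2 * m"
  have cross: "{{c i, d j} |i j. i < 2 * p \<and> j < 2 * q \<and> j < r i} \<union> {{a, b} |a b. a \<in> D1 \<and> b \<in> D2}
     = {{c' i, d' j} |i j. i < 2 * (p + m) \<and> j < 2 * (q - m) \<and> j < ?r i} \<union> {{a, b} |a b. a \<in> D1 \<and> b \<in> C}"
    (is "?L = ?R")
  proof (intro set_eqI iffI)
    fix e assume "e \<in> ?L"
    then consider i j where "e = {c i, d j}" "i < 2 * p" "j < 2 * q" "j < r i" "j < 2 * m"
      | i j where "e = {c i, d j}" "i < 2 * p" "j < 2 * q" "j < r i" "2 * m \<le> j"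
      | a b where "e = {a, b}" "a \<in> D1" "b \<in> D2" by (blast intro: leI)
    then show "e \<in> ?R"
    proof cases
      case 1
      then have "e = {d j, c i}" "d j \<in> D1" "c i \<in> C" unfolding D1_def C_def by auto
      then show ?thesis by blast
    next
      case 2
      then have "e = {c' (i + 2 * m), d' (j - 2 * m)}" "i + 2 * m < 2 * (p + m)"
        "j - 2 * m < 2 * (q - m)" "j - 2 * m < ?r (i + 2 * m)"
        using assms(1) by (auto simp: c'_def d'_def)
      then show ?thesis by blast
    next
      case 3
      then obtain i j where "a = d i" "i < 2 * m" "b = d j" "2 * m \<le> j" "j < 2 * q" by (auto simp: D1_def D2_def)
      then have "e = {c' i, d' (j - 2 * m)}" "i < 2 * (p + m)" "j - 2 * m < 2 * (q - m)" "j - 2 * m < ?r i"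
        using 3 assms(1) by (auto simp: c'_def d'_def)
      then show ?thesis by blast
    qed
  next
    fix e assume "e \<in> ?R"
    then consider i j where "e = {c' i, d' j}" "i < 2 * (p + m)" "j < 2 * (q - m)" "j < ?r i" "i < 2 * m"
      | i j where "e = {c' i, d' j}" "i < 2 * (p + m)" "j < 2 * (q - m)" "j < ?r i" "2 * m \<le> i"
      | a b where "e = {a, b}" "a \<in> D1" "b \<in> C" by (blast intro: leI)
    then show "e \<in> ?L"
    proof cases
      case 1
      then have "c' i \<in> D1" "d' j \<in> D2" using d' by (auto simp: c'_def D1_def)
      then show ?thesis using 1 by blast
    next
      case 2
      then have "e = {c (i - 2 * m), d (j + 2 * m)}" "i - 2 * m < 2 * p" "j + 2 * m < 2 * q" "j + 2 * m < r (i - 2 * m)"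
        using univ[of "i - 2 * m"] by (auto simp: c'_def d'_def)
      then show ?thesis by blast
    next
      case 3
      then obtain i j where ij: "a = d j" "j < 2 * m" "b = c i" "i < 2 * p" by (auto simp: D1_def C_def)
      then have "e = {c i, d j}" "j < 2 * q" "j < r i" using 3 assms(1) univ[of i] by auto
      then show ?thesis using ij by blast
    qed
  qed
  show "layout E (p + m) (q - m) c' d' ?r (\<lambda>j. k (j + 2 * m) + 2 * m)"
  proof
    show "inj_on c' {..<2 * (p + m)}"
    proof (rule inj_onI)
      fix i i' assume "i \<in> {..<2 * (p + m)}" "i' \<in> {..<2 * (p + m)}" "c' i = c' i'"
      moreover from this have "i - 2 * m < 2 * p" if "\<not> i < 2 * m" using that by auto
      moreover from calculation have "i' - 2 * m < 2 * p" if "\<not> i' < 2 * m" using that by auto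
      ultimately show "i = i'"
        using assms(1) d_eq[of i i'] c_eq[of "i - 2 * m" "i' - 2 * m"] c_neq_d[of "i - 2 * m" i'] c_neq_d[of "i' - 2 * m" i]
        by (cases "i < 2 * m"; cases "i' < 2 * m") (auto simp: c'_def)
    qed
    show "inj_on d' {..<2 * (q - m)}"
      using assms(1) d_eq by (auto simp: inj_on_def d'_def)
    show "c' ` {..<2 * (p + m)} \<inter> d' ` {..<2 * (q - m)} = {}"
      unfolding c' d' using dis by auto
    show "?r i \<le> 2 * (q - m)" if "i < 2 * (p + m)" for i
    proof (cases "i < 2 * m")
      case False
      then have "i - 2 * m < 2 * p" using that by auto
      then show ?thesis using r_le[of "i - 2 * m"] False by auto
    qed simp
    show "k (j + 2 * m) + 2 * m \<le> 2 * (p + m)" if "j < 2 * (q - m)" for j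
      using k_le[of "j + 2 * m"] that by auto
    show "j < ?r i \<longleftrightarrow> i < k (j + 2 * m) + 2 * m" if "i < 2 * (p + m)" "j < 2 * (q - m)" for i j
    proof (cases "i < 2 * m")
      case False
      then have "i - 2 * m < 2 * p" "j + 2 * m < 2 * q" using that by auto
      then show ?thesis using less_r_iff[of "i - 2 * m" "j + 2 * m"] False by auto
    qed (use that in auto)
    show "E = [c' ` {..<2 * (p + m)}]\<^bsup>2\<^esup> \<union> [d' ` {..<2 * (q - m)}]\<^bsup>2\<^esup>
        \<union> {{c' i, d' j} |i j. i < 2 * (p + m) \<and> j < 2 * (q - m) \<and> j < ?r i}"
      (is "_ = _ \<union> _ \<union> ?R'")
    proof -
      let ?L' = "{{c i, d j} |i j. i < 2 * p \<and> j < 2 * q \<and> j < r i}"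
      let ?DD = "{{a, b} |a b. a \<in> D1 \<and> b \<in> D2}" and ?DC = "{{a, b} |a b. a \<in> D1 \<and> b \<in> C}"
      have "D1 \<inter> C = {}" using dis(2) by (simp add: Int_commute)
      have "E = [C]\<^bsup>2\<^esup> \<union> ([D1]\<^bsup>2\<^esup> \<union> [D2]\<^bsup>2\<^esup> \<union> ?DD) \<union> ?L'"
        unfolding un[OF dis(1), symmetric] D[symmetric] C_def by (rule E_eq)
      also have "\<dots> = [D1]\<^bsup>2\<^esup> \<union> [C]\<^bsup>2\<^esup> \<union> [D2]\<^bsup>2\<^esup> \<union> (?L' \<union> ?DD)" by (simp only: Un_ac)
      also have "\<dots> = [D1]\<^bsup>2\<^esup> \<union> [C]\<^bsup>2\<^esup> \<union> [D2]\<^bsup>2\<^esup> \<union> (?R' \<union> ?DC)" by (simp only: cross)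
      also have "\<dots> = ([D1]\<^bsup>2\<^esup> \<union> [C]\<^bsup>2\<^esup> \<union> ?DC) \<union> [D2]\<^bsup>2\<^esup> \<union> ?R'" by (simp only: Un_ac)
      finally show ?thesis unfolding c' d' un[OF \<open>D1 \<inter> C = {}\<close>] .
    qed
  qed
qed

end

section \<open>Two staircases under a line\<close>

text \<open>
The values \<open>P * a s\<close> are bounded by the constant \<open>P * v\<close>, by the linear function \<open>M - Q * s\<close>, and beyond
\<open>u\<close> by the constant \<open>M - Q * u\<close>. The first two bounds meet at the real number \<open>x\<close>; the right-hand side is what
one gets by changing from the first to the second bound there. Changing at the integer \<open>n\<close> below \<open>x\<close> is no worse,
because \<open>(x - n) * (x - n - 1) \<le> 0\<close>.
\<close>

lemma sum_under_line_le:
  fixes a :: "nat \<Rightarrow> nat" and P Q u v M :: nat and x :: real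
  assumes "u \<le> P" "0 < P" "0 < Q"
    and a: "\<And>s. 1 \<le> s \<Longrightarrow> s \<le> P \<Longrightarrow> a s \<le> v \<and> P * a s + Q * min s u \<le> M"
    and M: "v * P \<le> M" "M < u * Q + v * P"
    and x: "x = (real M - real v * real P) / real Q"
  shows "2 * real P * (\<Sum>s=1..P. real (a s)) \<le>
    2 * real P * (real M - real Q * real u) + real Q * (real u - x) * (real u + x - 1)"
proof -
  define n where "n = nat \<lfloor>x\<rfloor>"
  have x0: "0 \<le> x" "x < u"
  proof -
    have "real (v * P) \<le> real M" "real M < real (u * Q + v * P)" using M by linarith+
    then show "0 \<le> x" "x < u" using assms(3) unfolding x by (simp_all add: field_simps)
  qed
  then have n: "real n \<le> x" "x < real n + 1" unfolding n_def by linarith+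
  then have nu: "n \<le> u" using x0 by linarith
  let ?S = "\<lambda>l. real P * (\<Sum>s=1..l. real (a s))"
  have a': "real P * real (a s) \<le> real P * real v" "real P * real (a s) \<le> real M - real Q * real (min s u)"
    if "1 \<le> s" "s \<le> P" for s
  proof -
    have "real (P * a s + Q * min s u) \<le> real M" using a[OF that] by linarith
    then show "real P * real (a s) \<le> real M - real Q * real (min s u)" by simp
    show "real P * real (a s) \<le> real P * real v" using a[OF that] by (simp add: mult_left_mono)
  qed
  have 1: "?S l \<le> real l * (real P * real v)" if "l \<le> n" for l
    using that
  proof (induction l)
    case (Suc l)
    have "?S (Suc l) = ?S l + real P * real (a (Suc l))" by (simp add: distrib_left)
    moreover have "real (Suc l) * (real P * real v) = real l * (real P * real v) + real P * real v"
      by (simp add: distrib_right)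
    ultimately show ?case using Suc a'(1)[of "Suc l"] nu assms(1) by linarith
  qed simp
  have 2: "?S l \<le> real n * (real P * real v) + (real l - real n) * real M
      - real Q * (real l * (real l + 1) - real n * (real n + 1)) / 2" if "n \<le> l" "l \<le> u" for l
    using that
  proof (induction l rule: dec_induct)
    case base
    show ?case using 1[of n] by simp
  next
    case (step l)
    then show ?case using a'(2)[of "Suc l"] assms(1) by (simp add: field_simps min_def)
  qed
  have 3: "?S l \<le> real n * (real P * real v) + (real u - real n) * real M
      - real Q * (real u * (real u + 1) - real n * (real n + 1)) / 2
      + (real l - real u) * (real M - real Q * real u)" if "u \<le> l" "l \<le> P" for l
    using that
  proof (induction l rule: dec_induct)
    case base
    show ?case using 2[of u] nu by simp
  next
    case (step l)
    then show ?case using a'(2)[of "Suc l"] by (simp add: field_simps min_def)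
  qed
  have Qx: "real P * real v = real M - real Q * x" using assms(3) unfolding x by (simp add: field_simps)
  have "(x - n) * (x - n - 1) \<le> 0" using n by (intro mult_nonneg_nonpos) auto
  then have "real Q * ((x - n) * (x - n - 1)) \<le> 0" by (simp add: mult_nonneg_nonpos)
  let ?bound = "real n * (real M - real Q * x) + (real u - real n) * real M
      - real Q * (real u * (real u + 1) - real n * (real n + 1)) / 2
      + (real P - real u) * (real M - real Q * real u)"
  have "2 * real P * (\<Sum>s=1..P. real (a s)) = 2 * ?S P" by simp
  also have "\<dots> \<le> 2 * ?bound"
    using 3[OF assms(1) order.refl, unfolded Qx] by (intro mult_left_mono) auto
  also have "\<dots> = 2 * real P * (real M - real Q * real u) + real Q * (real u - x) * (real u + x - 1)
      + real Q * ((x - n) * (x - n - 1))"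
    by (simp add: field_simps)
  also have "\<dots> \<le> 2 * real P * (real M - real Q * real u) + real Q * (real u - x) * (real u + x - 1) + 0"
    using \<open>real Q * ((x - n) * (x - n - 1)) \<le> 0\<close> by (intro add_left_mono)
  finally show ?thesis by simp
qed

text \<open>
With \<open>\<Delta> = u Q + v P - M\<close> the two bounds of \<open>sum_under_line_le\<close> add up to
\<open>M - \<Delta> + \<Delta> (2 M - P - Q) / (2 P Q)\<close>, which is less than \<open>M\<close> if \<open>\<Delta> > 0\<close>, because \<open>M \<le> P Q\<close>. If \<open>\<Delta> \<le> 0\<close> the
staircases are bounded by the rectangles \<open>P \<times> v\<close> and \<open>u \<times> Q\<close>. The strict inequality pays for an apex
that is not special.
\<close>

lemma two_staircases_le:
  fixes a b :: "nat \<Rightarrow> nat" and P Q u v M :: nat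
  assumes "u \<le> P" "v \<le> Q" "0 < P" "0 < Q" "M \<le> P * Q" "u * Q \<le> M" "v * P \<le> M"
    and a: "\<And>s. 1 \<le> s \<Longrightarrow> s \<le> P \<Longrightarrow> a s \<le> v \<and> P * a s + Q * min s u \<le> M"
    and b: "\<And>t. 1 \<le> t \<Longrightarrow> t \<le> Q \<Longrightarrow> b t \<le> u \<and> Q * b t + P * min t v \<le> M"
  shows "(\<Sum>s=1..P. a s) + (\<Sum>t=1..Q. b t) \<le> M"
    and "M < u * Q + v * P \<Longrightarrow> (\<Sum>s=1..P. a s) + (\<Sum>t=1..Q. b t) < M"
proof -
  let ?A = "\<Sum>s=1..P. a s" and ?B = "\<Sum>t=1..Q. b t"
  show strict: "?A + ?B < M" if M: "M < u * Q + v * P"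
  proof -
    define \<Delta> where "\<Delta> = real u * real Q + real v * real P - real M"
    have "real M < real (u * Q + v * P)" using M by linarith
    then have \<Delta>: "\<Delta> > 0" by (simp add: \<Delta>_def)
    define x where "x = (real M - real v * real P) / real Q"
    define y where "y = (real M - real u * real Q) / real P"
    have Qx: "real Q * x = real M - real v * real P" and Py: "real P * y = real M - real u * real Q"
      using assms(3,4) by (simp_all add: x_def y_def)
    have "real Q * (2 * real P * real ?A) \<le> real Q * (2 * real P * (real M - real Q * real u) + real Q * (real u - x) * (real u + x - 1))"
      using sum_under_line_le[OF assms(1,3,4) a assms(7) M x_def] by (intro mult_left_mono) auto
    moreover have "real P * (2 * real Q * real ?B) \<le> real P * (2 * real Q * (real M - real P * real v) + real P * (real v - y) * (real v + y - 1))"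
      using sum_under_line_le[OF assms(2,4,3) b assms(6) _ y_def] M by (intro mult_left_mono) (auto simp: add.commute)
    ultimately have "2 * real P * real Q * (real ?A + real ?B) \<le>
        2 * real P * real Q * (2 * real M - real Q * real u - real P * real v)
        + real Q * (real u - x) * (real Q * (real u + x - 1)) + real P * (real v - y) * (real P * (real v + y - 1))"
      by (simp add: algebra_simps)
    also have "real Q * (real u - x) = \<Delta>" using Qx by (simp add: \<Delta>_def algebra_simps)
    also have "real P * (real v - y) = \<Delta>" using Py by (simp add: \<Delta>_def algebra_simps)
    also have "2 * real P * real Q * (2 * real M - real Q * real u - real P * real v)
        + \<Delta> * (real Q * (real u + x - 1)) + \<Delta> * (real P * (real v + y - 1))
      = 2 * real P * real Q * (real M - \<Delta>) + \<Delta> * (2 * real M - real P - real Q)"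
    proof -
      have "real Q * (real u + x - 1) + real P * (real v + y - 1) = 2 * real M - real P - real Q"
        using Qx Py by (simp add: algebra_simps)
      then have "\<Delta> * (real Q * (real u + x - 1)) + \<Delta> * (real P * (real v + y - 1)) = \<Delta> * (2 * real M - real P - real Q)"
        by (metis distrib_left)
      moreover have "2 * real M - real Q * real u - real P * real v = real M - \<Delta>" by (simp add: \<Delta>_def algebra_simps)
      ultimately show ?thesis by (simp add: add.assoc)
    qed
    also have "\<dots> < 2 * real P * real Q * real M"
    proof -
      have "real M \<le> real (P * Q)" using assms(5) by linarith
      then have "2 * real M - real P - real Q < 2 * real P * real Q" using assms(3,4) by simp
      then have "\<Delta> * (2 * real M - real P - real Q) < \<Delta> * (2 * real P * real Q)" using \<Delta> by simp
      then show ?thesis by (simp add: algebra_simps)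
    qed
    finally have "real ?A + real ?B < real M" using assms(3,4) by simp
    then show ?thesis by linarith
  qed
  show "?A + ?B \<le> M"
  proof (cases "M < u * Q + v * P")
    case True
    then show ?thesis using strict by simp
  next
    case False
    have "?A \<le> (\<Sum>s=1..P. v)" "?B \<le> (\<Sum>t=1..Q. u)" using a b by (intro sum_mono; simp)+
    then show ?thesis using False by (simp add: mult.commute)
  qed
qed

section \<open>Sparse layouts\<close>

context layout
begin

lemma tau_le_two_nu_empty:
  assumes "p = 0 \<or> q = 0"
  shows "tau E \<le> 2 * nu E"
proof -
  have empty: "{(i, j). i < 2 * p \<and> j < r i \<and> (i < p \<longleftrightarrow> j < q)} = {}"
    using assms r_le by fastforce
  have "tau E \<le> p * (p - 1) + q * (q - 1) + card {(i, j). i < 2 * p \<and> j < r i \<and> (i < p \<longleftrightarrow> j < q)}"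
    using tau_le_same_side[of 0 0] by simp
  then have "tau E \<le> p * (p - 1) + q * (q - 1)" unfolding empty by simp
  then show ?thesis using rows_and_columns[of 0 0 0 0 0] by simp
qed

text \<open>
The cut through the middle of both cliques loses the quadrants of small and of large indices. The
former has at most \<open>p q\<close> cells, the latter is summed by columns.
\<close>

lemma tau_le_halves:
  assumes "0 < p" "0 < q"
  shows "tau E \<le> p * (p - 1) + q * (q - 1) + p * q + (\<Sum>t<r p - q. k (q + t) - p)"
proof -
  let ?S = "{(i, j). i < 2 * p \<and> j < r i \<and> (i < p \<longleftrightarrow> j < q)}"
  let ?B = "SIGMA t:{..<r p - q}. {..<k (q + t) - p}"
  have "?S \<subseteq> {..<p} \<times> {..<q} \<union> (\<lambda>(t, i). (p + i, q + t)) ` ?B"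
  proof (clarify)
    fix i j assume ij: "i < 2 * p" "j < r i" "i < p \<longleftrightarrow> j < q"
      and nB: "(i, j) \<notin> (\<lambda>(t, i). (p + i, q + t)) ` ?B"
    show "i \<in> {..<p} \<and> j \<in> {..<q}"
    proof (rule ccontr)
      assume "\<not> (i \<in> {..<p} \<and> j \<in> {..<q})"
      then have ge: "p \<le> i" "q \<le> j" using ij by auto
      have "j < 2 * q" using ij r_le[of i] by simp
      then have "i < k j" using less_r_iff[of i j] ij by simp
      moreover have "j < r p" using r_antimono[of p i] ij ge by simp
      ultimately have "(j - q, i - p) \<in> ?B" using ge by auto
      moreover have "(i, j) = (\<lambda>(t, i). (p + i, q + t)) (j - q, i - p)" using ge by simp
      ultimately show False using nB by blast
    qed
  qed
  then have "card ?S \<le> card ({..<p} \<times> {..<q} \<union> (\<lambda>(t, i). (p + i, q + t)) ` ?B)"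
    by (intro card_mono) auto
  also have "\<dots> \<le> card ({..<p} \<times> {..<q}) + card ((\<lambda>(t, i). (p + i, q + t)) ` ?B)" by (rule card_Un_le)
  also have "\<dots> \<le> p * q + card ?B" by (intro add_mono card_image_le) auto
  finally have "card ?S \<le> p * q + (\<Sum>t<r p - q. k (q + t) - p)" by simp
  then show ?thesis
    using tau_le_same_side[of 0 0] by simp
qed

text \<open>
The next three lemmas treat sparse layouts in which row \<open>p\<close> or column \<open>q\<close> is as long as the empty quadrant
permits. Then enough rows contain a whole window of columns.
\<close>

lemma sparse_full_row:
  assumes "0 < p" "p < q" "r p = q"
  shows "tau E \<le> 2 * nu E"
proof -
  have "p * (p - 1) + q * (q - 1) + ((p + 1) * (q - 1) + 0) + (0 * (p - 1) + 0) \<le> 2 * nu E"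
  proof (rule rows_and_columns[where t = 0])
    show "i < 2 * p \<and> q \<le> r i" if "i < p + 1" for i
      using r_antimono[of i p] that assms by simp
  qed (use assms in simp_all)
  moreover have "p * q \<le> (p + 1) * (q - 1)"
    using assms(2) by (cases q) auto
  ultimately show ?thesis using tau_le_halves assms by simp
qed

text \<open>
One vertex of the clique of columns is moved across the middle cut: the cut then loses only \<open>q - 1\<close>
cells in each of the first rows, which is what a row covers as an apex.
\<close>

lemma sparse_full_column:
  assumes "0 < p" "p \<le> q" "k q = p" "r p < q"
  shows "tau E \<le> 2 * nu E"
proof -
  have rq: "q < r i" if "i < p" for i using less_r_iff[of i q] that assms by simp
  have "p * (p - 1) + q * (q - 1) + (p * (q - 1) + 1) + (0 * (p - 1) + 0) \<le> 2 * nu E"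
  proof (rule rows_and_columns[where t = 0])
    show "i < 2 * p \<and> q \<le> r i" if "i < p" for i using rq[OF that] that by simp
    show "q < r 0" using rq assms(1) by simp
  qed (use assms in simp_all)
  moreover have "tau E \<le> p * (p - 1) + q * (q - 1) + 1 + p * (q - 1)"
  proof -
    let ?S = "{(i, j). i < 2 * p \<and> j < r i \<and> (i < p \<longleftrightarrow> j < q - 1)}"
    have "?S \<subseteq> {..<p} \<times> {..<q - 1}"
    proof clarify
      fix i j assume ij: "i < 2 * p" "j < r i" "i < p \<longleftrightarrow> j < q - 1"
      then show "i \<in> {..<p} \<and> j \<in> {..<q - 1}" using r_antimono[of p i] assms by (cases "i < p") auto
    qed
    then have "card ?S \<le> p * (q - 1)"
      using card_mono[of "{..<p} \<times> {..<q - 1}" ?S] by simp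
    then show ?thesis using tau_le_same_side[of 0 1] assms by simp
  qed
  ultimately show ?thesis by simp
qed

lemma sparse_full_row_column:
  assumes "0 < p" "p = q" "k q = p" "r p = q"
  shows "tau E \<le> 2 * nu E"
proof -
  have rq: "q < r 0" using less_r_iff[of 0 q] assms by simp
  have pk: "p < k j" if "j < q" for j using less_r_iff[of p j] that assms by simp
  have "p * (p - 1) + q * (q - 1) + (1 * (q - 1) + 1) + (q * (p - 1) + 0) \<le> 2 * nu E"
  proof (rule rows_and_columns[where t = 1])
    show "i < 2 * p \<and> q \<le> r i" if "i < 1" for i using rq assms(1) that by simp
    show "j < 2 * q \<and> 1 + p \<le> k j" if "j < q" for j using pk[OF that] that by simp
  qed (use assms rq in simp_all)
  moreover have "(1 * (q - 1) + 1) + (q * (p - 1) + 0) = p * q"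
    using assms by (cases q) auto
  ultimately show ?thesis using tau_le_halves assms by simp
qed

text \<open>
The main sparse case. The staircase \<open>a\<close> is the quadrant of late rows, with lengths truncated at \<open>p\<close> since
the window of \<open>p\<close> rows has not more than \<open>p\<close> colour classes; \<open>b\<close> is the quadrant of late columns. For a
corner \<open>(s, a s)\<close> the first \<open>s\<close> rows serve as apexes over the first \<open>q\<close> columns, and the first \<open>a s\<close> columns as
apexes over the \<open>p\<close> rows that follow; symmetrically for the corners of \<open>b\<close>. Cells are counted in the grid of
size \<open>P = p - 1\<close> by \<open>Q = q - 1\<close>, in accordance with \<open>rows_and_columns\<close>; this is why the staircases are
summed from \<open>1\<close> on, their value at \<open>0\<close> being paid for by moving one vertex across the cut.
\<close>

lemma sparse_corner:
  assumes p: "0 < p" "p \<le> q" and u: "k q < p" and v: "r p < q" and top: "r (2 * p - 1) \<le> p"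
  shows "tau E \<le> 2 * nu E"
proof -
  define P Q base where "P = p - 1" and "Q = q - 1" and "base = p * (p - 1) + q * (q - 1)"
  define a where "a s = min (r (p + s)) p" for s
  define b where "b t = k (q + t)" for t
  have a_mono: "a s' \<le> a s" if "s \<le> s'" "s' < p" for s s'
    using r_antimono[of "p + s" "p + s'"] that unfolding a_def by simp
  have b_mono: "b t' \<le> b t" if "t \<le> t'" "t' < q" for t t'
    using k_antimono[of "q + t" "q + t'"] that unfolding b_def by simp
  have b0: "b 0 < p" and a0: "a 0 \<le> r p" "a 0 \<le> p" using u by (auto simp: a_def b_def)
  have packs_a: "base + (s * Q + of_bool (0 < s)) + (a s * P + of_bool (0 < a s)) \<le> 2 * nu E" if "s \<le> b 0" for s
    unfolding base_def P_def Q_def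
  proof (rule rows_and_columns[where t = s])
    have s: "s < p" using that b0 by simp
    then show "s \<le> q" "s \<le> p" using p by auto
    have row: "i < 2 * p" "q < r i" if "i < s" for i
      using less_r_iff[of i q] that \<open>s \<le> b 0\<close> s v by (auto simp: b_def)
    then show "i < 2 * p \<and> q \<le> r i" if "i < s" for i using that by (simp add: less_imp_le)
    show "of_bool (0 < s) = (1::nat) \<Longrightarrow> q < r 0" using row[of 0] by (auto simp: of_bool_def split: if_splits)
    have column: "j < 2 * q" "p + s < k j" if "j < a s" for j
    proof -
      have "j < r (p + s)" using that by (simp add: a_def)
      then show "j < 2 * q" "p + s < k j" using less_r_iff[of "p + s" j] r_le[of "p + s"] s by auto
    qed
    then show "j < 2 * q \<and> s + p \<le> k j" if "j < a s" for j using that by (simp add: add.commute less_imp_le)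
    show "of_bool (0 < a s) = (1::nat) \<Longrightarrow> s + p < k 0" using column(2)[of 0] by (auto simp: of_bool_def add.commute split: if_splits)
    show "a s \<le> p" by (simp add: a_def)
  qed (auto simp: of_bool_def)
  have packs_b: "base + (t * P + of_bool (0 < t)) + (b t * Q + of_bool (0 < b t)) \<le> 2 * nu E" if "t \<le> a 0" for t
  proof -
    have "q * (q - 1) + p * (p - 1) + (t * (p - 1) + of_bool (0 < t)) + (b t * (q - 1) + of_bool (0 < b t)) \<le> 2 * nu E"
    proof (rule layout.rows_and_columns[OF swap, where t = t])
      have t: "t < q" "t \<le> p" using that a0 v by auto
      then show "t \<le> p" "t \<le> q" by auto
      have row: "i < 2 * q" "p < k i" if "i < t" for i
        using less_r_iff[of p i] that \<open>t \<le> a 0\<close> a0(1) t p by auto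
      then show "i < 2 * q \<and> p \<le> k i" if "i < t" for i using that by (simp add: less_imp_le)
      show "of_bool (0 < t) = (1::nat) \<Longrightarrow> p < k 0" using row[of 0] by (auto simp: of_bool_def split: if_splits)
      have column: "j < 2 * p" "q + t < r j" if "j < b t" for j
      proof -
        have "j < k (q + t)" using that by (simp add: b_def)
        then show "j < 2 * p" "q + t < r j" using less_r_iff[of j "q + t"] k_le[of "q + t"] t by auto
      qed
      then show "j < 2 * p \<and> t + q \<le> r j" if "j < b t" for j using that by (simp add: add.commute less_imp_le)
      show "of_bool (0 < b t) = (1::nat) \<Longrightarrow> t + q < r 0" using column(2)[of 0] by (auto simp: of_bool_def add.commute split: if_splits)
      show "b t \<le> q" using b_mono[of 0 t] t b0 p by simp
    qed (auto simp: of_bool_def)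
    then show ?thesis by (simp add: base_def P_def Q_def)
  qed
  have cut1: "tau E \<le> base + P * Q + 3"
  proof -
    let ?S = "{(i, j). i < 2 * p \<and> j < r i \<and> (i < P \<longleftrightarrow> j < Q)}"
    have "?S \<subseteq> insert (P, Q) ({..<P} \<times> {..<Q})"
    proof clarify
      fix i j assume ij: "i < 2 * p" "j < r i" "i < P \<longleftrightarrow> j < Q" and no: "\<not> (i \<in> {..<P} \<and> j \<in> {..<Q})"
      have "i < p"
      proof (rule ccontr)
        assume "\<not> i < p"
        then have "r i < q" using r_antimono[of p i] ij(1) v by simp
        then show False using ij \<open>\<not> i < p\<close> no by (auto simp: P_def Q_def)
      qed
      moreover have "\<not> q < r i" if "P \<le> i" "i < p"
        using less_r_iff[of i q] u ij p that by (auto simp: P_def)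
      ultimately show "i = P \<and> j = Q" using ij no by (auto simp: P_def Q_def)
    qed
    then have "card ?S \<le> P * Q + 1"
      using card_mono[of "insert (P, Q) ({..<P} \<times> {..<Q})" ?S] by (simp add: card_insert_if)
    then show ?thesis
      using tau_le_same_side[of 1 1] p unfolding base_def P_def Q_def by simp
  qed
  have cut2: "tau E \<le> base + of_bool (0 < a 0) + of_bool (0 < b 0) + (\<Sum>s=1..P. a s) + (\<Sum>t=1..Q. b t)"
  proof -
    have "\<exists>e\<le>p. e\<^sup>2 + (\<Sum>s\<in>{e..<p}. r (p + s)) \<le> of_bool (0 < a 0) + (\<Sum>s=1..P. a s)"
    proof (cases "r p = 0")
      case True
      then have "(\<Sum>s\<in>{0..<p}. r (p + s)) = 0" using r_antimono[of p] by fastforce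
      then show ?thesis by (intro exI[of _ 0]) simp
    next
      case False
      define l where "l = (LEAST s. r (p + s) \<le> p)"
      have "r (p + (p - 1)) \<le> p" using top p by (simp add: mult_2)
      then have l: "r (p + l) \<le> p" "l \<le> p - 1" unfolding l_def by (rule LeastI, rule Least_le)
      have small: "a s = r (p + s)" if "l \<le> s" "s < p" for s
        using r_antimono[of "p + l" "p + s"] l that by (simp add: a_def)
      have large: "a s = p" if "s < l" for s
        using not_less_Least[of s "\<lambda>s. r (p + s) \<le> p"] that unfolding l_def[symmetric] a_def by simp
      \<comment> \<open>The truncation of \<open>a\<close> is paid for by moving \<open>e\<close> vertices across the cut, where \<open>l\<close> counts the
        truncated rows. This needs \<open>l < p\<close>, which is the assumption on the last row.\<close>
      define e where "e = max l 1"
      have ep: "1 \<le> e" "e \<le> p" using l p by (auto simp: e_def)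
      have "{1..P} = {1..<e} \<union> {e..<p}" using ep p by (auto simp: P_def)
      then have "(\<Sum>s=1..P. a s) = (\<Sum>s\<in>{1..<e}. a s) + (\<Sum>s\<in>{e..<p}. a s)"
        by (simp add: sum.union_disjoint)
      also have "(\<Sum>s\<in>{1..<e}. a s) = (\<Sum>s\<in>{1..<e}. p)" using large by (intro sum.cong) (auto simp: e_def)
      also have "\<dots> = (e - 1) * p" by simp
      also have "(\<Sum>s\<in>{e..<p}. a s) = (\<Sum>s\<in>{e..<p}. r (p + s))" using small by (simp add: e_def)
      finally have sum: "(\<Sum>s=1..P. a s) = (e - 1) * p + (\<Sum>s\<in>{e..<p}. r (p + s))" .
      have "e\<^sup>2 \<le> 1 + (e - 1) * p"
      proof (cases "e = 1")
        case False
        then have "e + 1 \<le> p" using l ep by (auto simp: e_def)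
        then have "(e - 1) * (e + 1) \<le> (e - 1) * p" by (rule mult_le_mono2)
        moreover have "e\<^sup>2 = 1 + (e - 1) * (e + 1)" using ep by (cases e) (auto simp: power2_eq_square)
        ultimately show ?thesis by simp
      qed simp
      moreover have "0 < a 0" using False p by (simp add: a_def)
      ultimately show ?thesis using ep sum by (intro exI[of _ e]) simp
    qed
    then obtain e where e: "e \<le> p" "e\<^sup>2 + (\<Sum>s\<in>{e..<p}. r (p + s)) \<le> of_bool (0 < a 0) + (\<Sum>s=1..P. a s)" by blast
    have "\<exists>f\<le>q. f\<^sup>2 + (\<Sum>t\<in>{f..<q}. k (q + t)) \<le> of_bool (0 < b 0) + (\<Sum>t=1..Q. b t)"
    proof (cases "b 0 = 0")
      case True
      then have "(\<Sum>t\<in>{0..<q}. k (q + t)) = 0" using b_mono[of 0] by (fastforce simp: b_def)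
      then show ?thesis by (intro exI[of _ 0]) simp
    next
      case False
      have "{1..Q} = {1..<q}" using p by (auto simp: Q_def)
      then show ?thesis using False p by (intro exI[of _ 1]) (auto simp: b_def)
    qed
    then obtain f where f: "f \<le> q" "f\<^sup>2 + (\<Sum>t\<in>{f..<q}. k (q + t)) \<le> of_bool (0 < b 0) + (\<Sum>t=1..Q. b t)" by blast
    show ?thesis using tau_le_opposite_sides[OF e(1) f(1)] e(2) f(2) unfolding base_def by linarith
  qed
  have sum_a: "(\<Sum>s=1..P. a s) \<le> P * a 0" and sum_b: "(\<Sum>t=1..Q. b t) \<le> Q * b 0"
  proof -
    have "a s \<le> a 0" if "s \<in> {1..P}" for s using a_mono[of 0 s] that p by (auto simp: P_def)
    then show "(\<Sum>s=1..P. a s) \<le> P * a 0" using sum_bounded_above[of "{1..P}" a "a 0"] by simp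
    have "b t \<le> b 0" if "t \<in> {1..Q}" for t using b_mono[of 0 t] that p by (auto simp: Q_def)
    then show "(\<Sum>t=1..Q. b t) \<le> Q * b 0" using sum_bounded_above[of "{1..Q}" b "b 0"] by simp
  qed
  consider "a 0 = 0" | "b 0 = 0" | "0 < a 0" "0 < b 0" by blast
  then show ?thesis
  proof cases
    case 1
    then show ?thesis using packs_b[of 0] cut2 sum_a sum_b by (simp add: mult.commute)
  next
    case 2
    then show ?thesis using packs_a[of 0] cut2 sum_a sum_b by (simp add: mult.commute)
  next
    case 3
    have PQ: "b 0 \<le> P" "a 0 \<le> Q" "0 < P" "0 < Q"
      using 3 b0 a0 v p by (auto simp: P_def Q_def)
    define W where "W = (\<lambda>s. s * Q + a s * P) ` {..b 0} \<union> (\<lambda>t. t * P + b t * Q) ` {..a 0}"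
    define M where "M = Max W"
    have W: "finite W" "W \<noteq> {}" by (auto simp: W_def)
    have Ma: "s * Q + a s * P \<le> M" if "s \<le> b 0" for s
      unfolding M_def using that W by (intro Max_ge) (auto simp: W_def)
    have Mb: "t * P + b t * Q \<le> M" if "t \<le> a 0" for t
      unfolding M_def using that W by (intro Max_ge) (auto simp: W_def)
    have ends: "b 0 * Q \<le> M" "a 0 * P \<le> M" using Ma[of "b 0"] Mb[of "a 0"] by auto
    have bound_a: "a s \<le> a 0 \<and> P * a s + Q * min s (b 0) \<le> M" if "1 \<le> s" "s \<le> P" for s
    proof -
      have "a s \<le> a (min s (b 0))" "a s \<le> a 0" using a_mono that p by (auto simp: P_def)
      moreover have "a s * P \<le> a (min s (b 0)) * P" using \<open>a s \<le> a (min s (b 0))\<close> by (rule mult_le_mono1)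
      moreover have "min s (b 0) * Q + a (min s (b 0)) * P \<le> M" by (rule Ma) simp
      ultimately show ?thesis unfolding mult.commute[of P] mult.commute[of Q] by linarith
    qed
    have bound_b: "b t \<le> b 0 \<and> Q * b t + P * min t (a 0) \<le> M" if "1 \<le> t" "t \<le> Q" for t
    proof -
      have "b t \<le> b (min t (a 0))" "b t \<le> b 0" using b_mono that p by (auto simp: Q_def)
      moreover have "b t * Q \<le> b (min t (a 0)) * Q" using \<open>b t \<le> b (min t (a 0))\<close> by (rule mult_le_mono1)
      moreover have "min t (a 0) * P + b (min t (a 0)) * Q \<le> M" by (rule Mb) simp
      ultimately show ?thesis unfolding mult.commute[of P] mult.commute[of Q] by linarith
    qed
    have uv: "b 0 * Q \<le> P * Q" "a 0 * P \<le> P * Q" "0 < b 0 * Q" "0 < a 0 * P" using PQ 3 by (auto simp: mult.commute)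
    \<comment> \<open>An optimal corner has two special apexes unless it lies on a side of the grid; then \<open>M\<close> is small
      enough for the strict inequality.\<close>
    have opt: "(base + M + 2 \<le> 2 * nu E) \<or>
       (base + M + 1 \<le> 2 * nu E \<and> M \<le> P * Q \<and> M < b 0 * Q + a 0 * P)"
    proof -
      have "M \<in> W" unfolding M_def using W by (rule Max_in)
      then consider s where "s \<le> b 0" "M = s * Q + a s * P" | t where "t \<le> a 0" "M = t * P + b t * Q"
        by (auto simp: W_def)
      then show ?thesis
      proof cases
        case s: 1
        have sQ: "s * Q \<le> b 0 * Q" using s(1) by simp
        consider "0 < s" "0 < a s" | "s = 0" | "0 < s" "a s = 0" by blast
        then show ?thesis
        proof cases
          case 1
          then show ?thesis using packs_a[OF s(1)] s(2) by simp
        next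
          case 2
          then show ?thesis using packs_a[OF s(1)] s(2) uv \<open>0 < a 0\<close> by simp
        next
          case 3
          then have "M = s * Q" using s(2) by simp
          then have "M \<le> P * Q" "M < b 0 * Q + a 0 * P" using sQ uv by linarith+
          then show ?thesis using packs_a[OF s(1)] \<open>M = s * Q\<close> 3 by simp
        qed
      next
        case t: 2
        have tP: "t * P \<le> a 0 * P" using t(1) by simp
        consider "0 < t" "0 < b t" | "t = 0" | "0 < t" "b t = 0" by blast
        then show ?thesis
        proof cases
          case 1
          then show ?thesis using packs_b[OF t(1)] t(2) by simp
        next
          case 2
          then show ?thesis using packs_b[OF t(1)] t(2) uv \<open>0 < b 0\<close> by simp
        next
          case 3
          then have "M = t * P" using t(2) by simp
          then have "M \<le> P * Q" "M < b 0 * Q + a 0 * P" using tP uv by linarith+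
          then show ?thesis using packs_b[OF t(1)] \<open>M = t * P\<close> 3 by simp
        qed
      qed
    qed
    show ?thesis
    proof (cases "M \<le> P * Q")
      case True
      note le = two_staircases_le[OF PQ True ends bound_a bound_b]
      from opt show ?thesis
      proof
        assume "base + M + 2 \<le> 2 * nu E"
        then show ?thesis using le(1) cut2 3 by simp
      next
        assume *: "base + M + 1 \<le> 2 * nu E \<and> M \<le> P * Q \<and> M < b 0 * Q + a 0 * P"
        then have "(\<Sum>s=1..P. a s) + (\<Sum>t=1..Q. b t) < M" using le(2) by blast
        then show ?thesis using * cut2 3 by simp
      qed
    next
      case False
      then show ?thesis using opt cut1 by linarith
    qed
  qed
qed

section \<open>Dense layouts\<close>

text \<open>
The first \<open>l\<close> columns are apexes over the first \<open>p\<close> rows, and the next \<open>q\<close> columns form the window for the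
\<open>p + m\<close> rows that are complete to them. As \<open>p < q\<close>, at least \<open>p + 1\<close> rows fit, one more than fills
the quadrant of small indices. The quadrant of large indices has \<open>w t\<close> cells in its column \<open>t\<close>,
and \<open>S\<close> bounds them: either \<open>S < p\<close>, or the last row is so long that the bound on its length forces \<open>p \<le> q - p\<close>.
\<close>

lemma dense_unequal:
  assumes p: "0 < p" "p < q" and dense: "q < r p"
    and few: "k (2 * q - 1) \<le> 1" "r (2 * p - 1) \<le> 2 * (q - p) + 1"
  shows "tau E \<le> 2 * nu E"
proof -
  define n where "n = r p - q"
  define w where "w t = k (q + t) - p" for t
  have nq: "n < q"
  proof (rule ccontr)
    assume "\<not> n < q"
    then have "2 * q - 1 < r p" using r_le[of p] p by (simp add: n_def)
    then show False using less_r_iff[of p "2 * q - 1"] p few by simp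
  qed
  have wk: "k (q + t) = p + w t" "1 \<le> w t" if "t < n" for t
    using less_r_iff[of p "q + t"] that nq p by (auto simp: w_def n_def)
  have w_mono: "w t' \<le> w t" if "t \<le> t'" "t' < n" for t t'
    using k_antimono[of "q + t" "q + t'"] that nq by (simp add: w_def)
  have n0: "0 < n" using dense by (simp add: n_def)
  define l where "l = min n p"
  have l: "0 < l" "l \<le> n" "l \<le> p" using n0 p by (auto simp: l_def)
  define wl where "wl = w (l - 1)"
  have wl1: "1 \<le> wl" using wk(2)[of "l - 1"] l by (simp add: wl_def)
  define d' where "d' = q - p"
  have q: "q = p + d'" "1 \<le> d'" using p by (auto simp: d'_def)
  define m where "m = min wl d'"
  have m1: "1 \<le> m" using wl1 q by (simp add: m_def)
  \<comment> \<open>the second alternative is where the bound on the length of the last row enters\<close>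
  obtain S where S: "w 0 \<le> S" "S \<le> p - 1 \<or> S = p \<and> p \<le> d'"
  proof -
    have "w 0 \<le> p" using wk(1)[OF n0] k_le[of q] p by simp
    moreover have "w 0 \<le> p - 1" if "\<not> p \<le> d'"
    proof (rule ccontr)
      assume "\<not> w 0 \<le> p - 1"
      then have "2 * p - 1 < k q" using wk(1)[OF n0] p by simp
      then have "q < r (2 * p - 1)" using less_r_iff[of "2 * p - 1" q] p by simp
      then show False using few(2) that q by simp
    qed
    ultimately show ?thesis using that by blast
  qed
  have "l - 1 < n" using l by simp
  then have wlS: "wl \<le> S" using w_mono[of 0 "l - 1"] S(1) by (simp add: wl_def)
  have pack: "p * (p - 1) + q * (q - 1) + (l * (p - 1) + 1) + ((p + m) * (q - 1) + 0) \<le> 2 * nu E"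
  proof -
    have "q * (q - 1) + p * (p - 1) + (l * (p - 1) + 1) + ((p + m) * (q - 1) + 0) \<le> 2 * nu E"
    proof (rule layout.rows_and_columns[OF swap, where t = l])
      show "l \<le> p" "1 \<le> l" "l \<le> q" using l p by auto
      have row: "i < 2 * q" "p < k i" if "i < l" for i
        using less_r_iff[of p i] that l p dense by auto
      then show "i < 2 * q \<and> p \<le> k i" if "i < l" for i using that by (simp add: less_imp_le)
      show "p < k 0" using row[of 0] l by simp
      show "p + m \<le> q" using q by (simp add: m_def)
      have "q + (l - 1) < 2 * q" using l nq by simp
      have "p + m \<le> k (q + (l - 1))" using wk(1)[of "l - 1"] l by (simp add: m_def wl_def)
      then show "j < 2 * p \<and> l + q \<le> r j" if "j < p + m" for j
        using that less_r_iff[of j "q + (l - 1)"] k_le[OF \<open>q + (l - 1) < 2 * q\<close>] \<open>q + (l - 1) < 2 * q\<close> l by auto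
    qed auto
    then show ?thesis by simp
  qed
  have "(\<Sum>t<n. w t) = (\<Sum>t<l - 1. w t) + (\<Sum>t=l - 1..<n. w t)"
    using l by (simp add: lessThan_atLeast0 sum.atLeastLessThan_concat)
  also have "(\<Sum>t<l - 1. w t) \<le> (l - 1) * S"
  proof -
    have "w t \<le> S" if "t < l - 1" for t 
    proof -
      have "t < n" using l that by simp
      then show ?thesis using w_mono[of 0 t] S(1) by simp
    qed
    then show ?thesis using sum_bounded_above[of "{..<l - 1}" w S] by simp
  qed
  also have "(\<Sum>t=l - 1..<n. w t) \<le> (n - (l - 1)) * wl"
    using sum_bounded_above[of "{l - 1..<n}" w wl] w_mono[of "l - 1"] by (auto simp: wl_def)
  finally have sum: "(\<Sum>t<n. w t) \<le> (l - 1) * S + (n - (l - 1)) * wl" by simp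
  have "p * q + (\<Sum>t<n. w t) \<le> (l * (p - 1) + 1) + (p + m) * (q - 1)"
  proof -
    have "(p + m) * (q - 1) + p = p * q + m * (p + d' - 1)"
      using q p by (cases p) (auto simp: algebra_simps)
    moreover have "(\<Sum>t<n. w t) + p \<le> l * (p - 1) + 1 + m * (p + d' - 1)"
    proof (cases "n \<le> p")
      case True
      then have ln: "l = n" by (simp add: l_def)
      then have s1: "(\<Sum>t<n. w t) \<le> (l - 1) * S + wl" using sum l by simp
      show ?thesis
      proof (cases "S \<le> p - 1")
        case True
        have "(l - 1) * S + wl \<le> (l - 1) * (p - 1) + (p - 1)"
          using True wlS by (intro add_mono mult_le_mono) auto
        also have "\<dots> = l * (p - 1)" using l by (cases l) auto
        finally have "(\<Sum>t<n. w t) \<le> l * (p - 1)" using s1 by simp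
        moreover have "p + d' - 1 \<le> m * (p + d' - 1)" using m1 by simp
        ultimately show ?thesis using q by linarith
      next
        case False
        then have Sp: "S = p" "p \<le> d'" using S by auto
        then have "m = wl" using wlS by (simp add: m_def)
        obtain l' where l': "l = Suc l'" using l by (cases l) auto
        obtain p' where p': "p = Suc p'" using p by (cases p) auto
        have "wl + l' \<le> wl * (p + d' - 1)"
        proof -
          have "wl * (p' + 1) \<le> wl * (p + d' - 1)" using Sp p' by (intro mult_le_mono2) auto
          moreover have "p' \<le> wl * p'" using wl1 by simp
          moreover have "l' \<le> p'" using l l' p' by simp
          moreover have "wl * (p' + 1) = wl * p' + wl" by simp
          ultimately show ?thesis by linarith
        qed
        then show ?thesis using s1 \<open>m = wl\<close> Sp l' p' by (simp add: algebra_simps)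
      qed
    next
      case False
      then have lp: "l = p" by (simp add: l_def)
      have "(n - (l - 1)) * wl \<le> d' * wl" using nq lp q by (intro mult_le_mono1) auto
      then have s1: "(\<Sum>t<n. w t) \<le> (p - 1) * S + d' * wl" using sum unfolding lp by linarith
      obtain p' where p': "p = Suc p'" using p by (cases p) auto
      show ?thesis
      proof (cases "S \<le> p - 1")
        case True
        have "(p - 1) * S \<le> p' * p'" unfolding p' using True p' by (intro mult_le_mono) auto
        moreover have "l * (p - 1) = p' * p' + p'" unfolding lp p' by simp
        moreover have "d' * wl \<le> m * (p + d' - 1)"
        proof (cases "wl \<le> d'")
          case True
          then have "d' * wl \<le> (p + d' - 1) * wl" using p' by (intro mult_le_mono1) auto
          then show ?thesis using True by (simp add: m_def mult.commute)
        next
          case False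
          have "d' * wl \<le> d' * (p + d' - 1)" using True wlS q by (intro mult_le_mono2) auto
          then show ?thesis using False by (simp add: m_def)
        qed
        ultimately show ?thesis using s1 p' by linarith
      next
        case False
        then have Sp: "S = p" "p \<le> d'" using S by auto
        then have "m = wl" using wlS by (simp add: m_def)
        have "p' \<le> wl * p'" using wl1 by simp
        moreover have "(p - 1) * S = p' * p' + p'" "l * (p - 1) = p' * p' + p'" unfolding Sp(1) lp p' by simp_all
        moreover have "m * (p + d' - 1) = wl * p' + d' * wl" unfolding \<open>m = wl\<close> p' by (simp add: algebra_simps)
        ultimately show ?thesis using s1 p' by linarith
      qed
    qed
    ultimately show ?thesis by linarith
  qed
  then show ?thesis
    using tau_le_halves p pack unfolding n_def[symmetric] w_def[symmetric] by linarith
qed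

text \<open>
Here the windows start behind the quadrant of large indices, at \<open>n\<close> and \<open>m\<close>, so that the rectangle of the first \<open>m\<close> rows
and \<open>n\<close> columns is free for special apexes: row \<open>i < m\<close> is given the partner \<open>d i\<close>. For odd \<open>p\<close> each of the \<open>p\<close> rows
loses one cell to parity, and these special triangles make up for that loss.
\<close>

lemma dense_equal:
  assumes p: "0 < p" "p = q" and dense: "q < r p" "k q \<le> r p"
    and few: "k (2 * q - 1) \<le> 1" "r (2 * p - 1) \<le> 1"
  shows "tau E \<le> 2 * nu E"
proof -
  define n where "n = r p - q"
  define m where "m = k q - p"
  have nm: "r p = q + n" "k q = p + m" "1 \<le> m" "m \<le> n"
    using dense less_r_iff[of p q] p by (auto simp: n_def m_def)
  have np: "n < p"
  proof (rule ccontr)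
    assume "\<not> n < p"
    then have "2 * q - 1 < r p" using nm p by simp
    then show False using less_r_iff[of p "2 * q - 1"] p few by simp
  qed
  have "p * (p - 1) + q * (q - 1) + gain q p m + gain p n 0 \<le> 2 * nu E"
  proof (rule two_nu_ge[where t = n and t' = m and x = "\<lambda>i. if i < n then i else i + q"
      and x' = "\<lambda>i. if i < m then i else i + p"])
    show "i < 2 * p \<and> n + q \<le> r i" if "i < p" for i
      using r_antimono[of i p] nm(1) that by auto
    show "j < 2 * q \<and> m + p \<le> k j" if "j < n" for j
      using k_antimono[of j q] nm(2) that np p by auto
    show "(if i < n then i else i + q) < r i" if "i < m" for i
      using r_antimono[of i p] nm np that p by auto
  qed (use nm np p in \<open>auto simp: inj_on_def split: if_splits\<close>)
  moreover have "p * q + n * m \<le> gain q p m + gain p n 0"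
  proof -
    define f where "f = p - m"
    have f: "p = m + f" "1 \<le> f" using nm np by (auto simp: f_def)
    have mf: "m * f \<le> n * f" using nm by simp
    show ?thesis
    proof (cases "odd p")
      case True
      have "m + f \<le> 2 * m + n * (f - 1)"
      proof -
        have "f - 1 \<le> m * (f - 1)" "m * (f - 1) \<le> n * (f - 1)" using nm by auto
        then show ?thesis using nm f by linarith
      qed
      then have "p * p + n * m \<le> p * (p - 1) + 2 * m + n * (p - 1)"
        using f by (cases f) (auto simp: algebra_simps)
      then show ?thesis using True p by (simp add: gain_def)
    next
      case False
      have "m + f \<le> 2 + n * f"
      proof -
        have "m + f \<le> m * f + 1" using nm f by (cases m; cases f) auto
        then show ?thesis using mf by linarith
      qed
      then have "p * p + n * m \<le> p * (p - 1) + 2 + n * p"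
        using f by (cases f) (auto simp: algebra_simps)
      then show ?thesis using False p np nm by (simp add: gain_def)
    qed
  qed
  moreover have "(\<Sum>t<n. k (q + t) - p) \<le> n * m"
  proof -
    have "k (q + t) - p \<le> m" if "t < n" for t
      using k_antimono[of q "q + t"] that np p by (simp add: m_def)
    then show ?thesis using sum_bounded_above[of "{..<n}" "\<lambda>t. k (q + t) - p" m] by simp
  qed
  ultimately show ?thesis using tau_le_halves p unfolding n_def[symmetric] by linarith
qed

end

section \<open>Choosing the layout\<close>

definition imbalance :: "nat \<Rightarrow> nat \<Rightarrow> nat" where
  "imbalance p q = (p - q) + (q - p)"

text \<open>
The cell \<open>(p, q)\<close> is absent. The first two disjuncts cover the boxes in which this cell does not exist.
\<close>

definition sparse :: "nat \<Rightarrow> nat \<Rightarrow> (nat \<Rightarrow> nat) \<Rightarrow> bool" where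
  "sparse p q r \<longleftrightarrow> p = 0 \<or> q = 0 \<or> r p \<le> q"

lemma (in layout) sparse_swap: "sparse p q r \<longleftrightarrow> sparse q p k"
  using less_r_iff[of p q] by (auto simp: sparse_def not_less[symmetric])

text \<open>
The case left open by \<open>sparse_corner\<close> has more than \<open>p\<close> universal columns and \<open>p + 2 \<le> q\<close>. Moving two of them
gives a more balanced layout, which is again sparse.
\<close>

lemma (in layout) sparse_minimal:
  assumes "p \<le> q" "sparse p q r"
    and minimal: "\<And>p' q' c' d' r' k'. layout E p' q' c' d' r' k' \<Longrightarrow> sparse p' q' r' \<Longrightarrow>
      imbalance p q \<le> imbalance p' q'"
  shows "tau E \<le> 2 * nu E"
proof (cases "p = 0")
  case True
  then show ?thesis by (intro tau_le_two_nu_empty) simp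
next
  case False
  then have p: "0 < p" and rp: "r p \<le> q" using assms by (auto simp: sparse_def)
  have kq: "k q \<le> p" using less_r_iff[of p q] p rp assms(1) by (simp add: not_less[symmetric])
  consider "p < q" "r p = q" | "p = q" "r p = q" "k q < p" | "p = q" "r p = q" "k q = p"
    | "k q = p" "r p < q" | "k q < p" "r p < q" "r (2 * p - 1) \<le> p" | "k q < p" "r p < q" "p < r (2 * p - 1)"
  proof -
    have "r p = q \<or> r p < q" "k q = p \<or> k q < p" "p = q \<or> p < q" "r (2 * p - 1) \<le> p \<or> p < r (2 * p - 1)"
      using assms(1) rp kq by auto
    then show ?thesis using that by blast
  qed
  then show ?thesis
  proof cases
    case 1
    then show ?thesis using sparse_full_row p by blast
  next
    case 2
    then show ?thesis using layout.sparse_full_column[OF swap] p by simp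
  next
    case 3
    then show ?thesis using sparse_full_row_column p by blast
  next
    case 4
    then show ?thesis using sparse_full_column p assms(1) by blast
  next
    case 5
    then show ?thesis using sparse_corner p assms(1) by blast
  next
    case 6
    have "r (2 * p - 1) \<le> r p" using r_antimono[of p "2 * p - 1"] p by simp
    then have q: "p + 2 \<le> q" using 6 by simp
    have "2 * 1 \<le> r i" if "i < 2 * p" for i
    proof -
      have "i \<le> 2 * p - 1" "2 * p - 1 < 2 * p" using that by auto
      then have "r (2 * p - 1) \<le> r i" by (rule r_antimono)
      then show ?thesis using 6 p by linarith
    qed
    then obtain c' d' where lay: "layout E (p + 1) (q - 1) c' d'
        (\<lambda>i. if i < 2 * 1 then 2 * (q - 1) else r (i - 2 * 1) - 2 * 1) (\<lambda>j. k (j + 2 * 1) + 2 * 1)"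
      using shift[of 1] q by auto
    have "r (p - 1) \<le> q"
    proof -
      have "p - 1 < 2 * p" "q < 2 * q" "\<not> p - 1 < k q" using 6 p assms(1) by auto
      then show ?thesis using less_r_iff[of "p - 1" q] by simp
    qed
    then have "sparse (p + 1) (q - 1) (\<lambda>i. if i < 2 * 1 then 2 * (q - 1) else r (i - 2 * 1) - 2 * 1)"
      using q p by (auto simp: sparse_def)
    then have "imbalance p q \<le> imbalance (p + 1) (q - 1)" using minimal[OF lay] by blast
    then show ?thesis using q by (simp add: imbalance_def)
  qed
qed

text \<open>
Two universal rows could be moved to increase the imbalance \<open>q - p\<close>. Moving \<open>q - p + 1\<close> pairs of universal columns
would exchange the roles of the cliques and leave the imbalance \<open>q - p + 2\<close>.
\<close>

lemma (in layout) dense_maximal: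
  assumes "p \<le> q" "\<not> sparse p q r"
    and maximal: "\<And>p' q' c' d' r' k'. layout E p' q' c' d' r' k' \<Longrightarrow>
      imbalance p' q' \<le> imbalance p q"
  shows "tau E \<le> 2 * nu E"
proof -
  have p: "0 < p" and q: "0 < q" and rp: "q < r p" using assms(2) by (auto simp: sparse_def)
  have few_c: "k (2 * q - 1) \<le> 1"
  proof (rule ccontr)
    assume "\<not> k (2 * q - 1) \<le> 1"
    then have "2 * 1 \<le> k j" if "j < 2 * q" for j
    proof -
      have "j \<le> 2 * q - 1" "2 * q - 1 < 2 * q" using that by auto
      then have "k (2 * q - 1) \<le> k j" by (rule k_antimono)
      then show ?thesis using \<open>\<not> k (2 * q - 1) \<le> 1\<close> by linarith
    qed
    then have "\<exists>c' d' r' k'. layout E (q + 1) (p - 1) c' d' r' k'"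
      using layout.shift[OF swap, of 1] p by fastforce
    then have "imbalance (q + 1) (p - 1) \<le> imbalance p q" using maximal by blast
    then show False using assms(1) p by (simp add: imbalance_def)
  qed
  have few_d: "r (2 * p - 1) \<le> 2 * (q - p) + 1"
  proof (rule ccontr)
    assume "\<not> r (2 * p - 1) \<le> 2 * (q - p) + 1"
    then have "2 * (q - p + 1) \<le> r i" if "i < 2 * p" for i
    proof -
      have "i \<le> 2 * p - 1" "2 * p - 1 < 2 * p" using that by auto
      then have "r (2 * p - 1) \<le> r i" by (rule r_antimono)
      moreover have "2 * (q - p + 1) \<le> r (2 * p - 1)" using \<open>\<not> r (2 * p - 1) \<le> 2 * (q - p) + 1\<close> by simp
      ultimately show ?thesis by (rule order.trans[rotated])
    qed
    then have "\<exists>c' d' r' k'. layout E (p + (q - p + 1)) (q - (q - p + 1)) c' d' r' k'"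
      using shift[of "q - p + 1"] p assms(1) by fastforce
    then have "imbalance (p + (q - p + 1)) (q - (q - p + 1)) \<le> imbalance p q" using maximal by blast
    then show False using assms(1) p by (simp add: imbalance_def)
  qed
  consider "p < q" | "p = q" "k q \<le> r p" | "p = q" "r p \<le> k q" using assms(1) by linarith
  then show ?thesis
  proof cases
    case 1
    then show ?thesis using dense_unequal p rp few_c few_d by blast
  next
    case 2
    then show ?thesis using dense_equal p rp few_c few_d by simp
  next
    case 3
    have "p < k q" using less_r_iff[of p q] p q rp by simp
    moreover have "k (2 * q - 1) \<le> 1" "r (2 * p - 1) \<le> 1" using few_c few_d 3(1) by simp_all
    ultimately show ?thesis using layout.dense_equal[OF swap q 3(1)[symmetric] _ 3(2)] by blast
  qed
qed

text \<open>
The bound is the number of vertices, which does not depend on the layout; hence a layout of greatest imbalance exists.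
\<close>

lemma (in layout) imbalance_bound:
  assumes "\<not> sparse p q r"
  shows "imbalance p q < card (\<Union>E)"
proof -
  have p: "0 < p" "0 < q" using assms by (auto simp: sparse_def)
  have "c ` {..<2 * p} \<union> d ` {..<2 * q} \<subseteq> \<Union>E"
  proof
    fix v assume "v \<in> c ` {..<2 * p} \<union> d ` {..<2 * q}"
    then consider i where "v = c i" "i < 2 * p" | j where "v = d j" "j < 2 * q" by blast
    then show "v \<in> \<Union>E"
    proof cases
      case 1
      define i' :: nat where "i' = (if i = 0 then 1 else 0)"
      have "i' < 2 * p" "i \<noteq> i'" using p by (auto simp: i'_def)
      then have "{c i, c i'} \<in> E" using 1 c_eq[of i i'] unfolding E_eq by auto
      then show ?thesis using 1 by blast
    next
      case 2
      define j' :: nat where "j' = (if j = 0 then 1 else 0)"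
      have "j' < 2 * q" "j \<noteq> j'" using p by (auto simp: j'_def)
      then have "{d j, d j'} \<in> E" using 2 d_eq[of j j'] unfolding E_eq by auto
      then show ?thesis using 2 by blast
    qed
  qed
  moreover have "\<Union>E \<subseteq> c ` {..<2 * p} \<union> d ` {..<2 * q}"
    using fin_graph by (auto simp: fin_simple_graph_def nsets_def)
  ultimately have "\<Union>E = c ` {..<2 * p} \<union> d ` {..<2 * q}" by (rule subset_antisym[rotated])
  then have "card (\<Union>E) = 2 * p + 2 * q"
    using disj inj_c inj_d by (simp add: card_Un_disjoint card_image)
  then show ?thesis using p by (simp add: imbalance_def)
qed

lemma layout_tau_le_two_nu:
  assumes "layout E p0 q0 c0 d0 r0 k0"
  shows "tau E \<le> 2 * nu E"
proof (cases "\<exists>p q c d r k. layout E p q c d r k \<and> sparse p q r")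
  case True
  define L where "L = (\<lambda>(p, q). \<exists>c d r k. layout E p q c d r k \<and> sparse p q r)"
  have "\<exists>pq. L pq" using True by (auto simp: L_def)
  then obtain pq where "L pq" and min: "\<And>pq'. L pq' \<Longrightarrow> case_prod imbalance pq \<le> case_prod imbalance pq'"
    using ex_has_least_nat[of L _ "case_prod imbalance"] by blast
  then obtain p q c d r k where pq: "pq = (p, q)" and lay: "layout E p q c d r k" "sparse p q r"
    by (auto simp: L_def)
  have min': "imbalance p q \<le> imbalance p' q'" if "layout E p' q' c' d' r' k'" "sparse p' q' r'" for p' q' c' d' r' k'
    using min[of "(p', q')"] that unfolding pq L_def by auto
  show ?thesis
  proof (cases "p \<le> q")
    case True
    then show ?thesis using layout.sparse_minimal[OF lay(1) True lay(2)] min' by blast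
  next
    case False
    have "imbalance q p \<le> imbalance p' q'" if "layout E p' q' c' d' r' k'" "sparse p' q' r'" for p' q' c' d' r' k'
      using min'[OF that] by (simp add: imbalance_def)
    then show ?thesis
      using False layout.sparse_minimal[OF layout.swap[OF lay(1)]] lay layout.sparse_swap[OF lay(1)]
      by (metis nat_le_linear)
  qed
next
  case False
  define L where "L = (\<lambda>(p, q). \<exists>c d r k. layout E p q c d r k)"
  have "L (p0, q0)" using assms by (auto simp: L_def)
  moreover have "\<forall>pq. L pq \<longrightarrow> case_prod imbalance pq < card (\<Union>E)"
    using layout.imbalance_bound False by (fastforce simp: L_def)
  ultimately obtain pq where "L pq" and max: "\<And>pq'. L pq' \<Longrightarrow> case_prod imbalance pq' \<le> case_prod imbalance pq"
    using ex_has_greatest_nat[of L "(p0, q0)" "case_prod imbalance" "card (\<Union>E)"] by blast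
  then obtain p q c d r k where pq: "pq = (p, q)" and lay: "layout E p q c d r k"
    by (auto simp: L_def)
  have max': "imbalance p' q' \<le> imbalance p q" if "layout E p' q' c' d' r' k'" for p' q' c' d' r' k'
    using max[of "(p', q')"] that unfolding pq L_def by auto
  have dense: "\<not> sparse p q r" using False lay by blast
  show ?thesis
  proof (cases "p \<le> q")
    case True
    then show ?thesis using layout.dense_maximal[OF lay True dense] max' by blast
  next
    case False
    have "imbalance p' q' \<le> imbalance q p" if "layout E p' q' c' d' r' k'" for p' q' c' d' r' k'
      using max'[OF that] by (simp add: imbalance_def)
    then show ?thesis
      using False layout.dense_maximal[OF layout.swap[OF lay]] dense layout.sparse_swap[OF lay]
      by (metis nat_le_linear)
  qed
qed

lemma initial_segment:
  assumes "\<And>i. Suc i < n \<Longrightarrow> S (Suc i) \<Longrightarrow> S i" and "i < n"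
  shows "S i \<longleftrightarrow> i < card {j. j < n \<and> S j}"
proof -
  have down: "S i" if "i \<le> j" "j < n" "S j" for i j
    using that by (induction j rule: dec_induct) (use assms(1) in auto)
  show ?thesis
  proof
    assume "S i"
    then have "{..i} \<subseteq> {j. j < n \<and> S j}" using down assms(2) by auto
    then have "card {..i} \<le> card {j. j < n \<and> S j}" by (intro card_mono) auto
    then show "i < card {j. j < n \<and> S j}" by simp
  next
    assume *: "i < card {j. j < n \<and> S j}"
    show "S i"
    proof (rule ccontr)
      assume "\<not> S i"
      then have "{j. j < n \<and> S j} \<subseteq> {..<i}" using down by (auto simp: not_less[symmetric])
      then have "card {j. j < n \<and> S j} \<le> i" using card_mono[of "{..<i}"] by force
      then show False using * by simp
    qed
  qed
qed

text \<open>
The given order of \<open>K2\<close> has increasing neighbourhoods, so it is reversed.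
\<close>

lemma co_chain_layout:
  assumes "co_chain V E K1 K2" "even (card K1)" "even (card K2)"
  shows "\<exists>c d r k. layout E (card K1 div 2) (card K2 div 2) c d r k"
proof -
  define a b where "a = card K1" and "b = card K2"
  obtain c d where V: "finite V" "E \<subseteq> [V]\<^bsup>2\<^esup>" "K1 \<union> K2 = V" "K1 \<inter> K2 = {}" "clique K1 E" "clique K2 E"
    and c: "bij_betw c {1..a} K1" and d: "bij_betw d {1..b} K2"
    and nc: "\<And>i. i \<in> {1..<a} \<Longrightarrow> nbhd E (c (i + 1)) \<inter> K2 \<subseteq> nbhd E (c i) \<inter> K2"
    and nd: "\<And>i. i \<in> {1..<b} \<Longrightarrow> nbhd E (d i) \<inter> K1 \<subseteq> nbhd E (d (i + 1)) \<inter> K1"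
    using assms(1) unfolding co_chain_def co_bipartite_def fin_simple_graph_def a_def b_def by blast
  have ab: "2 * (a div 2) = a" "2 * (b div 2) = b" using assms(2,3) by (auto simp: a_def b_def)
  define c' d' where "c' i = c (Suc i)" and "d' j = d (b - j)" for i j :: nat
  define A where "A i j \<longleftrightarrow> {c' i, d' j} \<in> E" for i j
  have c': "bij_betw c' {..<a} K1"
  proof -
    have "bij_betw Suc {..<a} {1..a}"
      by (rule bij_betwI[where g = "\<lambda>i. i - 1"]) auto
    from bij_betw_trans[OF this c] show ?thesis unfolding c'_def comp_def .
  qed
  have d': "bij_betw d' {..<b} K2"
  proof -
    have "bij_betw (\<lambda>j. b - j) {..<b} {1..b}"
      by (rule bij_betwI[where g = "\<lambda>i. b - i"]) auto
    from bij_betw_trans[OF this d] show ?thesis unfolding d'_def comp_def .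
  qed
  have img: "c' ` {..<a} = K1" "d' ` {..<b} = K2" using c' d' by (auto simp: bij_betw_def)
  have cK: "c' i \<in> K1" if "i < a" for i using img that by auto
  have dK: "d' j \<in> K2" if "j < b" for j using img that by auto
  have Ac: "A i j" if "A (Suc i) j" "Suc i < a" "j < b" for i j
  proof -
    have "d' j \<in> nbhd E (c (Suc i + 1)) \<inter> K2" using that dK by (simp add: A_def nbhd_def c'_def)
    then have "d' j \<in> nbhd E (c (Suc i))" using nc[of "Suc i"] that by auto
    then show ?thesis by (simp add: A_def nbhd_def c'_def)
  qed
  have Ad: "A i j" if "A i (Suc j)" "Suc j < b" "i < a" for i j
  proof -
    have "c' i \<in> nbhd E (d (b - Suc j)) \<inter> K1"
      using that cK by (simp add: A_def nbhd_def d'_def insert_commute)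
    moreover have "b - Suc j + 1 = b - j" "b - Suc j \<in> {1..<b}" using that by auto
    ultimately have "c' i \<in> nbhd E (d (b - j))" using nd[of "b - Suc j"] by auto
    then show ?thesis by (simp add: A_def nbhd_def d'_def insert_commute)
  qed
  define r k where "r i = card {j. j < b \<and> A i j}" and "k j = card {i. i < a \<and> A i j}" for i j
  have r: "A i j \<longleftrightarrow> j < r i" if "i < a" "j < b" for i j
    unfolding r_def by (rule initial_segment[where S = "A i"]) (use Ad that in auto)
  have k: "A i j \<longleftrightarrow> i < k j" if "i < a" "j < b" for i j
    unfolding k_def by (rule initial_segment[where S = "\<lambda>i. A i j"]) (use Ac that in auto)
  have "layout E (a div 2) (b div 2) c' d' r k"
  proof
    show "inj_on c' {..<2 * (a div 2)}" "inj_on d' {..<2 * (b div 2)}"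
      unfolding ab using c' d' by (auto simp: bij_betw_def)
    show "c' ` {..<2 * (a div 2)} \<inter> d' ` {..<2 * (b div 2)} = {}" unfolding ab img by (rule V)
    show "r i \<le> 2 * (b div 2)" for i
      unfolding ab r_def using card_mono[of "{..<b}" "{j. j < b \<and> A i j}"] by auto
    show "k j \<le> 2 * (a div 2)" for j
      unfolding ab k_def using card_mono[of "{..<a}" "{i. i < a \<and> A i j}"] by auto
    show "j < r i \<longleftrightarrow> i < k j" if "i < 2 * (a div 2)" "j < 2 * (b div 2)" for i j
      using r[of i j] k[of i j] that unfolding ab by simp
    show "E = [c' ` {..<2 * (a div 2)}]\<^bsup>2\<^esup> \<union> [d' ` {..<2 * (b div 2)}]\<^bsup>2\<^esup>
      \<union> {{c' i, d' j} |i j. i < 2 * (a div 2) \<and> j < 2 * (b div 2) \<and> j < r i}"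
      unfolding ab img
    proof (intro subset_antisym subsetI)
      fix e assume e: "e \<in> E"
      then have "e \<in> [K1 \<union> K2]\<^bsup>2\<^esup>" using V by auto
      then obtain u v where uv: "e = {u, v}" "u \<noteq> v" "u \<in> K1 \<union> K2" "v \<in> K1 \<union> K2"
        by (auto simp: nsets_def card_2_iff)
      have cross: "e \<in> {{c' i, d' j} |i j. i < a \<and> j < b \<and> j < r i}" if "e = {u, v}" "u \<in> K1" "v \<in> K2" for u v
      proof -
        have "u \<in> c' ` {..<a}" "v \<in> d' ` {..<b}" using that img by auto
        then obtain i j where ij: "u = c' i" "i < a" "v = d' j" "j < b" by auto
        then have "A i j" using e \<open>e = {u, v}\<close> by (simp add: A_def)
        then have "e = {c' i, d' j}" "j < r i" using r[of i j] ij \<open>e = {u, v}\<close> by auto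
        then show ?thesis using ij by blast
      qed
      show "e \<in> [K1]\<^bsup>2\<^esup> \<union> [K2]\<^bsup>2\<^esup> \<union> {{c' i, d' j} |i j. i < a \<and> j < b \<and> j < r i}"
        using uv cross[of u v] cross[of v u] by (auto simp: insert_commute)
    next
      fix e assume "e \<in> [K1]\<^bsup>2\<^esup> \<union> [K2]\<^bsup>2\<^esup> \<union> {{c' i, d' j} |i j. i < a \<and> j < b \<and> j < r i}"
      then consider "e \<in> [K1]\<^bsup>2\<^esup>" | "e \<in> [K2]\<^bsup>2\<^esup>" | i j where "e = {c' i, d' j}" "i < a" "j < b" "j < r i" by blast
      then show "e \<in> E"
      proof cases
        case 1
        then show ?thesis using V(5) by (auto simp: nsets_def card_2_iff clique_def)
      next
        case 2
        then show ?thesis using V(6) by (auto simp: nsets_def card_2_iff clique_def)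
      next
        case 3
        then show ?thesis using r[of i j] by (simp add: A_def)
      qed
    qed
  qed
  then show ?thesis unfolding a_def b_def by blast
qed

theorem theorem1:
  fixes V K1 K2 :: "'a set" and E :: "'a set set"
  assumes "co_chain V E K1 K2"
    and "even (card K1)" and "even (card K2)"
  shows "tau E \<le> 2 * nu E"
  using co_chain_layout[OF assms] layout_tau_le_two_nu by blast

end
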